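(* Let $1\le q\le 2$ and $f\in L^q(\mathbb C)$. Suppose $f\times\mu_r(x)=f\times\mu_r(ix)=0$ for all $r>0$ and all $x\in\mathbb R$. Then $f=0$ almost everywhere.
   Context: $L^q(\mathbb C)$ is taken with respect to Lebesgue measure. For $r>0$, $\mu_r$ is the normalized arc-length measure on the circle $\{w\in\mathbb C:|w|=r\}$, and the twisted spherical mean of $f$ is $$f\times\mu_r(z)=\int_{|w|=r} f(z-w)\,e^{\frac i2\operatorname{Im}(z\bar w)}\,d\mu_r(w).$$ *)

theory Defs
  imports "HOL-Analysis.Analysis"
begin

text \<open>Elements are functions rather than almost-everywhere classes.\<close>

definition Lspace :: "real \<Rightarrow> (complex \<Rightarrow> complex) set" where
  "Lspace q =
    {f. f \<in> borel_measurable lebesgue \<and> integrable lebesgue (\<lambda>z. norm (f z) powr q)}"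

text \<open>
  The completion matters: a Lebesgue measurable function on the plane restricts to almost every
  circle about a given point as a function that agrees almost everywhere with a Borel function,
  but that need not itself be Borel measurable.
\<close>

definition circle_measure :: "real \<Rightarrow> complex measure" where
  "circle_measure r =
    completion (distr (uniform_measure lborel {0..<2 * pi}) borel (\<lambda>t. of_real r * cis t))"

text \<open>
  For \<open>f\<close> in \<^term>\<open>Lspace q\<close>, \<open>q \<ge> 1\<close>, and fixed \<open>z\<close> the integrand is integrable for almost every
  \<open>r > 0\<close>; for the exceptional radii the Bochner integral has the value 0 by convention.
\<close>

definition twisted_mean :: "(complex \<Rightarrow> complex) \<Rightarrow> real \<Rightarrow> complex \<Rightarrow> complex" where
  "twisted_mean f r z =
    (\<integral>w. f (z - w) * exp (\<i> / 2 * of_real (Im (z * cnj w))) \<partial>circle_measure r)"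

end

theory Submission
  imports Defs "HOL-Probability.Distributions"
begin

text \<open>
  Integrating the twisted means about a point \<open>z\<close> against a radial Gaussian shows, up to a nonzero
  factor, that \<open>f e\<^bsup>-t|u|\<^sup>2\<^esup>\<close> is orthogonal to \<open>exp (z* u (t + 1/4) + z u* (t - 1/4))\<close> for all
  \<open>t > 0\<close>, where \<open>*\<close> is conjugation. Expanding in powers of \<open>z\<close> along the two axes makes it orthogonal to
  \<open>(A u + B u*)\<^sup>n\<close> and \<open>(A u - B u*)\<^sup>n\<close> with \<open>A = 4t + 1\<close>, \<open>B = 4t - 1\<close>. The moments of
  \<open>f e\<^bsup>-t|u|\<^sup>2\<^esup>\<close> against \<open>u\<^sup>j u*\<^sup>k\<close> are linked by differentiation in \<open>t\<close>, and comparing the relations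
  of degree \<open>n\<close> and \<open>n + 2\<close> forces all of them to vanish for \<open>t > 1/4\<close>. A Stone--Weierstrass
  argument then gives \<open>f = 0\<close> almost everywhere.
\<close>

section \<open>Lebesgue measure on the complex plane\<close>

text \<open>The twist is what makes two axes suffice. For ordinary circle means the claim fails: Re
  z * Im z * exp(-|z|^2) is odd in each coordinate, so its means about all points of both axes
  vanish. In the proof the twist appears as A - B = 2; with A = B the extra relation obtained in
  even degree would only repeat the one already known. Degree n involves n + 1 moments, while the
  axes supply two relations. The count closes because a moment with both indices positive is, up to
  sign, the t-derivative of a moment of degree n - 2, so only the two moments with a zero index are
  new. For even n the two axes yield the same relation, which is why a second one has to be fetched
  from degree n + 2. The bound t > 1/4 keeps B away from 0. The Gaussian weight is chosen because
  the twist and the shifted Gaussian together contribute an exponent that is linear in u and its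
  conjugate apart from -t|u|^2, and because t remains a free parameter to differentiate in.\<close>

lemma lborel_complex_eq_distr_vec:
  "(lborel :: complex measure) = distr (lborel :: (real^2) measure) borel (\<lambda>v. Complex (v$1) (v$2))"
proof (rule lborel_eqI)
  fix l u :: complex
  assume le: "\<And>b. b \<in> Basis \<Longrightarrow> l \<bullet> b \<le> u \<bullet> b"
  have le': "Re l \<le> Re u" "Im l \<le> Im u"
    using le[of 1] le[of \<i>] by (auto simp: Basis_complex_def inner_complex_def)
  have [measurable]: "(\<lambda>v::real^2. Complex (v$1) (v$2)) \<in> borel_measurable borel"
    by (intro borel_measurable_continuous_onI continuous_on_Complex continuous_intros)
  have "(\<lambda>v::real^2. Complex (v$1) (v$2)) -` box l u = box (vector [Re l, Im l]) (vector [Re u, Im u])"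
    by (auto simp: box_def Basis_complex_def inner_complex_def Basis_vec_def inner_axis forall_2 axis_eq_axis)
  moreover have B: "(Basis :: (real^2) set) = {axis 1 1, axis 2 1}"
    by (auto simp: Basis_vec_def UNIV_2)
  ultimately show "emeasure (distr lborel borel (\<lambda>v::real^2. Complex (v$1) (v$2))) (box l u)
      = ennreal (\<Prod>b\<in>Basis. (u - l) \<bullet> b)"
    using le' by (simp add: emeasure_distr emeasure_lborel_box_eq B Basis_complex_def
        inner_complex_def inner_axis axis_eq_axis)
qed simp

text \<open>A unit factor acts on coordinates as an orthogonal map, and orthogonal maps of
  \<open>real^2\<close> preserve Lebesgue measure. Boxes are enough to identify the measure.\<close>

lemma lborel_complex_distr_mult:
  assumes "norm (c :: complex) = 1"
  shows "distr lborel borel (\<lambda>z. c * z) = lborel"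
proof -
  define J where "J = (\<lambda>v::real^2. Complex (v$1) (v$2))"
  \<comment> \<open>\<open>T\<close> is the inverse rotation, multiplication by
    \<open>cnj c\<close>, in coordinates: the preimage of a box under multiplication by
    \<open>c\<close> is the image under \<open>T\<close>, and orthogonal invariance speaks of
    images.\<close>
  define T where "T = (\<lambda>v::real^2. vector [Re (cnj c * J v), Im (cnj c * J v)] :: real^2)"
  have c1: "cnj c * c = 1" "c * cnj c = 1"
    using assms by (simp_all add: complex_norm_square[symmetric] mult.commute)
  have J: "J \<in> borel_measurable borel"
    unfolding J_def by (intro borel_measurable_continuous_onI continuous_on_Complex continuous_intros)
  have normJ: "norm (J v) = norm v" for v
    by (simp add: J_def cmod_def norm_vec_def L2_set_def sum_2)
  have JT: "J (T v) = cnj c * J v" for v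
    by (simp add: T_def J_def complex_eq_iff)
  have "linear T"
    by (rule linearI) (auto simp: T_def J_def vec_eq_iff forall_2 algebra_simps)
  moreover have "norm (T v) = norm v" for v
    using assms by (metis JT normJ norm_mult complex_mod_cnj mult_1)
  ultimately have T: "orthogonal_transformation T"
    by (simp add: orthogonal_transformation)
  have injJ: "J v = J w \<Longrightarrow> v = w" for v w
    by (auto simp: J_def vec_eq_iff forall_2)
  have surjJ: "\<exists>v. J v = z" for z
    by (rule exI[of _ "vector [Re z, Im z]"]) (simp add: J_def)
  have "lborel = distr lborel borel (\<lambda>z. c * z)"
  proof (rule lborel_eqI)
    fix l u :: complex
    assume le: "\<And>b. b \<in> Basis \<Longrightarrow> l \<bullet> b \<le> u \<bullet> b"
    let ?S = "J -` box l u"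
    have S: "?S \<in> sets borel"
      using measurable_sets[OF J, of "box l u"] by simp
    have eS: "emeasure lborel (box l u) = emeasure lborel ?S"
      using J by (subst lborel_complex_eq_distr_vec) (simp add: emeasure_distr J_def)
    have "emeasure lborel ?S < \<infinity>"
      using eS emeasure_lborel_box_finite[of l u] by simp
    then have lS: "?S \<in> lmeasurable"
      using S by (auto intro!: fmeasurableI)
    have im: "T ` ?S = J -` ((\<lambda>z. c * z) -` box l u)"
    proof (intro set_eqI iffI)
      fix v assume "v \<in> T ` ?S"
      then obtain w where w: "w \<in> ?S" "v = T w"
        by blast
      then have "c * J v = J w"
        by (metis JT c1(2) mult.assoc mult_1)
      then show "v \<in> J -` ((\<lambda>z. c * z) -` box l u)"
        using w by simp
    next
      fix v assume v: "v \<in> J -` ((\<lambda>z. c * z) -` box l u)"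
      obtain w where w: "J w = c * J v" using surjJ by blast
      then have "J (T w) = J v"
        by (metis JT c1(1) mult.assoc mult_1)
      then have "T w = v" using injJ by blast
      then show "v \<in> T ` ?S" using v w by auto
    qed
    have m: "(\<lambda>z. c * z) \<in> borel_measurable borel"
      by measurable
    have S': "J -` ((\<lambda>z. c * z) -` box l u) \<in> sets borel"
      using measurable_sets[OF measurable_compose[OF J m], of "box l u"] by (simp add: vimage_def)
    have "emeasure (distr lborel borel (\<lambda>z. c * z)) (box l u) = emeasure lborel ((\<lambda>z. c * z) -` box l u)"
      using m by (simp add: emeasure_distr)
    also have "\<dots> = emeasure lborel (T ` ?S)"
      using J measurable_sets[OF m, of "box l u"] unfolding im
      by (subst lborel_complex_eq_distr_vec) (simp add: emeasure_distr J_def)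
    also have "\<dots> = emeasure lebesgue (T ` ?S)"
      using S' im by simp
    also have "\<dots> = emeasure lebesgue ?S"
      using measurable_orthogonal_image[OF T lS] measure_orthogonal_image[OF T lS] lS
      by (simp add: emeasure_eq_measure2)
    also have "\<dots> = emeasure lborel (box l u)"
      using S eS by simp
    finally show "emeasure (distr lborel borel (\<lambda>z. c * z)) (box l u) = ennreal (\<Prod>b\<in>Basis. (u - l) \<bullet> b)"
      using le by (simp add: emeasure_lborel_box_eq)
  qed simp
  then show ?thesis by simp
qed

lemma integrable_exp_neg_norm_sq:
  assumes "0 < c"
  shows "integrable lborel (\<lambda>z::complex. exp (- c * (norm z)\<^sup>2))"
proof (rule integrableI_bounded)
  show "(\<lambda>z::complex. exp (- c * (norm z)\<^sup>2)) \<in> borel_measurable lborel"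
    by measurable
  have 1: "integrable lborel (\<lambda>x::real. exp (- c * x\<^sup>2))"
  proof -
    \<comment> \<open>The standard deviation with 1 / (2 s^2) = c, so that the Gaussian is a
      multiple of a centred normal density.\<close>
    define s where "s = sqrt (1 / (2 * c))"
    have s: "0 < s" "2 * s\<^sup>2 = 1 / c"
      using assms by (simp_all add: s_def)
    have "integrable lborel (\<lambda>x. sqrt (2 * pi * s\<^sup>2) * normal_density 0 s x)"
      using s(1) by (intro integrable_mult_right integrable_normal_density) 
    then show ?thesis
      using s by (simp add: normal_density_def mult.commute)
  qed
  have eq: "ennreal (norm (exp (- c * (norm z)\<^sup>2))) = (\<Prod>b\<in>Basis. ennreal (exp (- c * (z \<bullet> b)\<^sup>2)))" for z :: complex
    by (simp add: Basis_complex_def inner_complex_def cmod_power2 ennreal_mult[symmetric] exp_add[symmetric] algebra_simps)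
  have "(\<integral>\<^sup>+z. ennreal (norm (exp (- c * (norm (z::complex))\<^sup>2))) \<partial>lborel)
      = (\<Prod>b\<in>(Basis::complex set). (\<integral>\<^sup>+x. ennreal (exp (- c * x\<^sup>2)) \<partial>lborel))"
    unfolding eq by (rule nn_integral_lborel_prod) auto
  also have "\<dots> < \<infinity>"
    using 1 by (simp add: nn_integral_eq_integral Basis_complex_def ennreal_mult[symmetric])
  finally show "(\<integral>\<^sup>+z. ennreal (norm (exp (- c * (norm (z::complex))\<^sup>2))) \<partial>lborel) < \<infinity>" .
qed

section \<open>Circle means\<close>

text \<open>Completeness makes \<open>f\<close> measurable as soon as it agrees almost everywhere
  with a measurable \<open>g\<close>. This handles a Lebesgue measurable function on a circle, where
  it need not be Borel.\<close>

lemma integral_completion_AE: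
  fixes f g :: "'a \<Rightarrow> 'b::{banach, second_countable_topology}"
  assumes g [measurable]: "g \<in> borel_measurable M" and eq: "AE x in M. f x = g x"
  shows "integral\<^sup>L (completion M) f = integral\<^sup>L M g"
proof -
  have eq': "AE x in completion M. f x = g x"
    using eq by (rule AE_completion)
  have g': "g \<in> borel_measurable (completion M)"
    by (rule measurable_completion) measurable
  have "f \<in> borel_measurable (completion M)"
  proof (rule measurableI)
    fix A :: "'b set" assume A: "A \<in> sets borel"
    show "f -` A \<inter> space (completion M) \<in> sets (completion M)"
    proof (rule completion.in_sets_AE)
      show "g -` A \<inter> space (completion M) \<in> sets (completion M)"
        using g' A by (rule measurable_sets)
      show "AE x in completion M. x \<in> g -` A \<inter> space (completion M) \<longleftrightarrow> x \<in> f -` A \<inter> space (completion M)"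
        using eq' by eventually_elim auto
    qed auto
  qed simp
  then have "integral\<^sup>L (completion M) f = integral\<^sup>L (completion M) g"
    using g' eq' by (rule integral_cong_AE)
  then show ?thesis
    by (simp add: integral_completion)
qed

lemma completion_ex_borel_measurable_complex:
  fixes f :: "'a \<Rightarrow> complex"
  assumes f: "f \<in> borel_measurable (completion M)"
  obtains g where "g \<in> borel_measurable M" "AE x in M. f x = g x"
proof -
  have "(\<lambda>x. Re (f x)) \<in> borel_measurable (completion M)" "(\<lambda>x. Im (f x)) \<in> borel_measurable (completion M)"
    using f by measurable
  from this[THEN completion_ex_borel_measurable_real]
  obtain a b where [measurable]: "a \<in> borel_measurable M" "b \<in> borel_measurable M"
    and ae: "AE x in M. Re (f x) = a x" "AE x in M. Im (f x) = b x"
    by auto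
  have "(\<lambda>x. complex_of_real (a x) + \<i> * complex_of_real (b x)) \<in> borel_measurable M"
    by measurable
  moreover have "AE x in M. f x = complex_of_real (a x) + \<i> * complex_of_real (b x)"
    using ae by eventually_elim (simp add: complex_eq_iff)
  ultimately show ?thesis by (rule that)
qed

section \<open>Uniform angles and rotation invariance\<close>

definition angle_measure :: "real measure" where
  "angle_measure = uniform_measure lborel {0..<2 * pi}"

lemma sets_angle_measure [measurable_cong, simp]: "sets angle_measure = sets borel"
  by (simp add: angle_measure_def)

lemma space_angle_measure [simp]: "space angle_measure = UNIV"
  by (simp add: angle_measure_def)

interpretation angle: prob_space angle_measure
  unfolding angle_measure_def by (rule prob_space_uniform_measure) auto

interpretation angle_lborel: pair_sigma_finite angle_measure "lborel :: complex measure" ..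

lemma cis_borel_measurable [measurable]: "cis \<in> borel_measurable borel"
  by (intro borel_measurable_continuous_onI continuous_intros)

text \<open>Multiplication by c = cis \<alpha> shifts the angle by \<alpha>. The shifted period
  [\<alpha>, \<alpha> + 2 pi) is cut at 2 pi and the overhang is moved back to [0, \<alpha>) by
  periodicity of \<open>cis\<close>.\<close>

lemma distr_angle_mult_unit:
  assumes "norm (c :: complex) = 1"
  shows "distr angle_measure borel (\<lambda>t. c * cis t) = distr angle_measure borel cis"
proof (rule measure_eqI)
  fix A assume "A \<in> sets (distr angle_measure borel (\<lambda>t. c * cis t))"
  then have A [measurable]: "A \<in> sets borel" by simp
  define \<alpha> where "\<alpha> = Arg2pi c"
  have \<alpha>: "0 \<le> \<alpha>" "\<alpha> < 2 * pi" "c = cis \<alpha>"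
    using Arg2pi[of c] assms by (auto simp: \<alpha>_def cis_conv_exp mult.commute is_Arg_def)
  let ?g = "\<lambda>t. indicator A (cis t) :: ennreal"
  have *: "emeasure lborel ({0..<2 * pi} \<inter> (\<lambda>t. d * cis t) -` A)
      = (\<integral>\<^sup>+t. indicator {0..<2 * pi} t * indicator A (d * cis t) \<partial>lborel)" for d
  proof -
    have "(\<lambda>t. d * cis t) -` A \<in> sets borel"
      using measurable_sets[of "\<lambda>t. d * cis t" borel borel A] by simp
    then have "emeasure lborel ({0..<2 * pi} \<inter> (\<lambda>t. d * cis t) -` A)
        = (\<integral>\<^sup>+t. indicator ({0..<2 * pi} \<inter> (\<lambda>t. d * cis t) -` A) t \<partial>lborel)"
      by (intro nn_integral_indicator[symmetric]) auto
    also have "\<dots> = (\<integral>\<^sup>+t. indicator {0..<2 * pi} t * indicator A (d * cis t) \<partial>lborel)"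
      by (intro nn_integral_cong) (auto simp: indicator_def)
    finally show ?thesis .
  qed
  have "(\<integral>\<^sup>+t. indicator {0..<2 * pi} t * indicator A (c * cis t) \<partial>lborel)
      = (\<integral>\<^sup>+t. indicator {0..<2 * pi} (- \<alpha> + 1 * t) * indicator A (c * cis (- \<alpha> + 1 * t)) \<partial>lborel)"
    by (subst nn_integral_real_affine[where c = 1 and t = "- \<alpha>"]) auto
  also have "\<dots> = (\<integral>\<^sup>+t. indicator {\<alpha>..<2 * pi} t * ?g t
      + indicator {2 * pi..<\<alpha> + 2 * pi} t * ?g t \<partial>lborel)"
    using \<alpha> by (intro nn_integral_cong) (auto simp: cis_mult split: split_indicator)
  also have "\<dots> = (\<integral>\<^sup>+t. indicator {\<alpha>..<2 * pi} t * ?g t \<partial>lborel)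
      + (\<integral>\<^sup>+t. indicator {2 * pi..<\<alpha> + 2 * pi} t * ?g t \<partial>lborel)"
    by (rule nn_integral_add) auto
  also have "(\<integral>\<^sup>+t. indicator {2 * pi..<\<alpha> + 2 * pi} t * ?g t \<partial>lborel)
      = (\<integral>\<^sup>+t. indicator {2 * pi..<\<alpha> + 2 * pi} (2 * pi + 1 * t) * ?g (2 * pi + 1 * t) \<partial>lborel)"
    by (subst nn_integral_real_affine[where c = 1 and t = "2 * pi"]) auto
  also have "\<dots> = (\<integral>\<^sup>+t. indicator {0..<\<alpha>} t * ?g t \<partial>lborel)"
    by (intro nn_integral_cong) (auto simp: cis_mult[symmetric] split: split_indicator)
  also have "(\<integral>\<^sup>+t. indicator {\<alpha>..<2 * pi} t * ?g t \<partial>lborel) + \<dots>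
      = (\<integral>\<^sup>+t. indicator {\<alpha>..<2 * pi} t * ?g t + indicator {0..<\<alpha>} t * ?g t \<partial>lborel)"
    by (rule nn_integral_add[symmetric]) auto
  also have "\<dots> = (\<integral>\<^sup>+t. indicator {0..<2 * pi} t * indicator A (1 * cis t) \<partial>lborel)"
    using \<alpha> by (intro nn_integral_cong) (auto split: split_indicator)
  finally have "emeasure lborel ({0..<2 * pi} \<inter> (\<lambda>t. c * cis t) -` A)
      = emeasure lborel ({0..<2 * pi} \<inter> (\<lambda>t. 1 * cis t) -` A)"
    unfolding * .
  moreover have "(\<lambda>t. d * cis t) -` A \<in> sets borel" for d
    using measurable_sets[of "\<lambda>t. d * cis t" borel borel A] by simp
  note this[of c] this[of 1]
  ultimately show "emeasure (distr angle_measure borel (\<lambda>t. c * cis t)) A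
      = emeasure (distr angle_measure borel cis) A"
    by (simp add: emeasure_distr angle_measure_def)
qed simp

lemma distr_angle_mult:
  "distr angle_measure borel (\<lambda>t. w * cis t) = distr angle_measure borel (\<lambda>t. of_real (norm w) * cis t)"
proof (cases "w = 0")
  case False
  define c where "c = w / of_real (norm w)"
  have c: "norm c = 1" "w = of_real (norm w) * c"
    using False by (simp_all add: c_def norm_divide)
  have "distr angle_measure borel (\<lambda>t. w * cis t)
      = distr (distr angle_measure borel (\<lambda>t. c * cis t)) borel (\<lambda>z. of_real (norm w) * z)"
    by (subst c(2)) (simp add: distr_distr comp_def mult.assoc)
  also have "\<dots> = distr angle_measure borel (\<lambda>t. of_real (norm w) * cis t)"
    by (simp add: distr_angle_mult_unit[OF c(1)] distr_distr comp_def)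
  finally show ?thesis .
qed simp

lemma cnj_borel_measurable [measurable]: "cnj \<in> borel_measurable borel"
  by (intro borel_measurable_continuous_onI continuous_intros)

abbreviation circle_distr :: "real \<Rightarrow> complex measure" where
  "circle_distr r \<equiv> distr angle_measure borel (\<lambda>t. of_real r * cis t)"

text \<open>
  Averaging \<open>\<integral> h (cis t * w) dw = \<integral> h\<close> over \<open>t\<close> replaces polar coordinates: the inner mean over
  \<open>t\<close> is the mean of \<open>h\<close> over the circle through \<open>w\<close>.
\<close>

lemma integral_eq_0_if_circle_means_0:
  fixes h :: "complex \<Rightarrow> complex"
  assumes h: "integrable lborel h"
    and mean: "AE w :: complex in lborel. (\<integral>z. h z \<partial>circle_distr (norm w)) = 0"
  shows "(\<integral>z. h z \<partial>lborel) = 0"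
proof -
  have [measurable]: "h \<in> borel_measurable borel"
    using borel_measurable_integrable[OF h] by simp
  have m: "(\<lambda>w. cis t * w) \<in> measurable lborel borel" for t
    by measurable
  note D = lborel_complex_distr_mult[OF norm_cis]
  have rot: "integrable lborel (\<lambda>w. h (cis t * w))"
      "(\<integral>w. norm (h (cis t * w)) \<partial>lborel) = (\<integral>w. norm (h w) \<partial>lborel)"
      "(\<integral>w. h (cis t * w) \<partial>lborel) = (\<integral>w. h w \<partial>lborel)" for t
  proof -
    show "integrable lborel (\<lambda>w. h (cis t * w))"
      using integrable_distr[OF m[of t], of h] h by (simp only: D)
    show "(\<integral>w. norm (h (cis t * w)) \<partial>lborel) = (\<integral>w. norm (h w) \<partial>lborel)"
      by (subst (2) D[of t, symmetric], subst integral_distr) auto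
    show "(\<integral>w. h (cis t * w) \<partial>lborel) = (\<integral>w. h w \<partial>lborel)"
      by (subst (2) D[of t, symmetric], subst integral_distr) auto
  qed
  \<comment> \<open>The integral of the norm over \<open>w\<close> is the same for every
    \<open>t\<close> and the angle measure is finite, which gives integrability on the
    product.\<close>
  have "integrable (angle_measure \<Otimes>\<^sub>M lborel) (\<lambda>(t, w). h (cis t * w))"
    by (rule angle_lborel.Fubini_integrable) (use rot in \<open>auto simp: split_beta'\<close>)
  then have "(\<integral>w. (\<integral>t. h (cis t * w) \<partial>angle_measure) \<partial>lborel)
      = (\<integral>t. (\<integral>w. h (cis t * w) \<partial>lborel) \<partial>angle_measure)"
    by (rule angle_lborel.Fubini_integral)
  also have "\<dots> = (\<integral>w. h w \<partial>lborel)"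
    by (simp add: rot angle.prob_space[simplified])
  also have "(\<integral>t. h (cis t * w) \<partial>angle_measure) = (\<integral>z. h z \<partial>circle_distr (norm w))" for w
    using integral_distr[of "\<lambda>t. w * cis t" angle_measure borel h]
    by (simp add: distr_angle_mult mult.commute)
  then have "(\<integral>w. (\<integral>t. h (cis t * w) \<partial>angle_measure) \<partial>lborel) = 0"
    using mean by (simp add: integral_eq_zero_AE)
  finally show ?thesis by simp
qed

text \<open>A null set stays null under every rotation about 0. Exchanging the quantifiers over
  \<open>t\<close> and \<open>w\<close> shows that almost every circle meets it in a null set of
  angles. Circles are indexed by the points \<open>w\<close> they pass through, so no measure on
  radii is needed.\<close>

lemma AE_circle_distr:
  assumes "AE z in lborel. P z"
  shows "AE w :: complex in lborel. AE z in circle_distr (norm w). P z"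
proof -
  \<comment> \<open>A Borel superset makes the relevant set of pairs measurable, as the exchange of
    quantifiers requires.\<close>
  obtain N where N: "{z. \<not> P z} \<subseteq> N" "emeasure lborel N = 0" "N \<in> sets borel"
    using AE_E[OF assms] by auto
  note [measurable] = N(3)
  have "AE w in lborel. w \<notin> N"
    using N by (auto intro!: AE_not_in simp: null_sets_def)
  then have "AE w in distr lborel borel (\<lambda>w. cis t * w). w \<notin> N" for t
    by (simp only: lborel_complex_distr_mult[OF norm_cis])
  moreover have "(\<lambda>w. cis t * w) \<in> measurable lborel borel" "{w \<in> space borel. w \<notin> N} \<in> sets borel" for t
    by measurable
  note AE_distr_iff[OF this]
  ultimately have "AE w in lborel. cis t * w \<notin> N" for t
    by blast
  then have "AE t in angle_measure. AE w in lborel. cis t * w \<notin> N"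
    by simp
  moreover have "Measurable.pred (angle_measure \<Otimes>\<^sub>M (lborel :: complex measure)) (\<lambda>x. cis (fst x) * snd x \<notin> N)"
    by measurable
  note angle_lborel.AE_commute[where P = "\<lambda>t w. cis t * w \<notin> N", OF predE[OF this]]
  ultimately have "AE w in lborel. AE t in angle_measure. cis t * w \<notin> N"
    by blast
  then show ?thesis
  proof (rule eventually_mono)
    fix w
    assume "AE t in angle_measure. cis t * w \<notin> N"
    then have *: "AE t in angle_measure. w * cis t \<notin> N"
      by (subst mult.commute)
    have m: "(\<lambda>t. w * cis t) \<in> measurable angle_measure borel" "{w \<in> space borel. w \<notin> N} \<in> sets borel"
      by measurable
    have "AE z in distr angle_measure borel (\<lambda>t. w * cis t). z \<notin> N"
      using * by (rule AE_distr_iff[OF m, THEN iffD2])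
    then have "AE z in circle_distr (norm w). z \<notin> N"
      unfolding distr_angle_mult[of w] .
    then show "AE z in circle_distr (norm w). P z"
      by (rule AE_mp) (use N(1) in auto)
  qed
qed

section \<open>From twisted means to integrals with a radial weight\<close>

lemma lborel_distr_diff: "distr lborel borel (\<lambda>w. z - w :: complex) = lborel"
  using lborel_affine[of "-1" z] by (simp add: density_1)

text \<open>Almost every circle about \<open>z\<close> meets the exceptional set of \<open>f\<close>
  and \<open>g\<close> in a null set, and there the completed measure does not distinguish them.
  From here on only Borel functions and uncompleted measures occur.\<close>

lemma twisted_mean_eq:
  assumes g [measurable]: "g \<in> borel_measurable borel" and eq: "AE u in lborel. f u = g u"
  shows "AE w :: complex in lborel. twisted_mean f (norm w) z
    = (\<integral>v. g (z - v) * exp (\<i> / 2 * of_real (Im (z * cnj v))) \<partial>circle_distr (norm w))"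
proof -
  have "AE v in lborel. f (z - v) = g (z - v)"
  proof -
    obtain N where N: "{u. f u \<noteq> g u} \<subseteq> N" "emeasure lborel N = 0" "N \<in> sets borel"
      using AE_E[OF eq] by auto
    note [measurable] = N(3)
    have "AE u in distr lborel borel (\<lambda>w. z - w). u \<notin> N"
      unfolding lborel_distr_diff using N by (auto intro!: AE_not_in simp: null_sets_def)
    then have "AE v in lborel. z - v \<notin> N"
      by (subst (asm) AE_distr_iff) auto
    then show ?thesis
      by (rule AE_mp) (use N(1) in auto)
  qed
  from AE_circle_distr[OF this] show ?thesis
  proof eventually_elim
    case (elim w)
    have "(\<lambda>v. g (z - v) * exp (\<i> / 2 * of_real (Im (z * cnj v)))) \<in> borel_measurable (circle_distr (norm w))"
      by measurable
    then show ?case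
      unfolding twisted_mean_def circle_measure_def angle_measure_def[symmetric]
      using elim by (intro integral_completion_AE) (auto elim!: eventually_mono)
  qed
qed

text \<open>The radial factor is constant on each circle, so it leaves the circle mean, and what
  remains is a twisted mean.\<close>

lemma twisted_radial_integral_eq_0:
  assumes g [measurable]: "g \<in> borel_measurable borel" and eq: "AE u in lborel. f u = g u"
    and k [measurable]: "k \<in> borel_measurable borel"
    and zero: "\<And>r. 0 < r \<Longrightarrow> twisted_mean f r z = 0"
    and int: "integrable lborel (\<lambda>v. g (z - v) * exp (\<i> / 2 * of_real (Im (z * cnj v))) * k (norm v))"
  shows "(\<integral>v. g (z - v) * exp (\<i> / 2 * of_real (Im (z * cnj v))) * k (norm v) \<partial>lborel) = 0"
proof (rule integral_eq_0_if_circle_means_0[OF int])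
  let ?h = "\<lambda>v. g (z - v) * exp (\<i> / 2 * of_real (Im (z * cnj v)))"
  \<comment> \<open>Only positive radii are covered by the hypothesis; the circle of radius 0
    corresponds to the single point 0.\<close>
  have "AE w :: complex in lborel. w \<noteq> (0::complex)"
    by (rule AE_lborel_singleton)
  then show "AE w :: complex in lborel. (\<integral>v. ?h v * k (norm v) \<partial>circle_distr (norm w)) = 0"
    using twisted_mean_eq[OF g eq, of z]
  proof eventually_elim
    case (elim w)
    then have "(\<integral>v. ?h v \<partial>circle_distr (norm w)) = 0"
      using zero[of "norm w"] by simp
    then show ?case
      by (simp add: integral_distr norm_mult)
  qed
qed

section \<open>Differentiating exponential integrals\<close>

text \<open>The second-order Taylor remainder of exp is absorbed by the spare factor exp(\<delta>
  |L|), which leaves an error of order (x - a)^2. It serves twice: with \<open>L\<close> linear in z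
  and z*, and with L = -|z|^2 for the derivative in t.\<close>

lemma has_vector_derivative_integral_exp:
  fixes F L :: "'a \<Rightarrow> complex"
  assumes [measurable]: "F \<in> borel_measurable M" "L \<in> borel_measurable M"
    and \<delta>: "0 < \<delta>" and int: "integrable M (\<lambda>z. norm (F z) * exp (\<delta> * norm (L z)))"
  shows "((\<lambda>x. \<integral>z. F z * exp (of_real (x - a) * L z) \<partial>M) has_vector_derivative (\<integral>z. F z * L z \<partial>M)) (at a)"
proof -
  define I where "I = (\<integral>z. norm (F z) * exp (\<delta> * norm (L z)) \<partial>M)"
  \<comment> \<open>Half of \<delta> bounds the exponential for |h| \<le> \<delta> / 2. The other
    half pays for |L|^2: with x = \<delta> |L| / 2 one has |L|^2 = (8 / \<delta>^2) (x^2 / 2) and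
    x^2 / 2 \<le> exp x.\<close>
  define C where "C = 8 / \<delta>\<^sup>2 * I"
  have intx: "integrable M (\<lambda>z. F z * exp (of_real h * L z))" if "\<bar>h\<bar> \<le> \<delta>" for h :: real
  proof (rule Bochner_Integration.integrable_bound[OF int])
    have "norm (exp (of_real h * L z)) \<le> exp (\<delta> * norm (L z))" for z
    proof -
      have "norm (exp (of_real h * L z)) \<le> exp (norm (of_real h * L z))"
        by (rule norm_exp)
      also have "\<dots> \<le> exp (\<delta> * norm (L z))"
        using that by (simp add: norm_mult mult_right_mono)
      finally show ?thesis .
    qed
    then show "AE z in M. norm (F z * exp (of_real h * L z)) \<le> norm (norm (F z) * exp (\<delta> * norm (L z)))"
      by (simp add: norm_mult mult_left_mono)
  qed measurable
  have int0: "integrable M F"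
    using intx[of 0] \<delta> by simp
  have int1: "integrable M (\<lambda>z. F z * L z)"
  proof (rule Bochner_Integration.integrable_bound)
    show "integrable M (\<lambda>z. 1 / \<delta> * (norm (F z) * exp (\<delta> * norm (L z))))"
      using int by (rule integrable_mult_right)
    have "norm (L z) \<le> 1 / \<delta> * exp (\<delta> * norm (L z))" for z
    proof -
      have "\<delta> * norm (L z) \<le> exp (\<delta> * norm (L z))"
        using exp_ge_add_one_self[of "\<delta> * norm (L z)"] by linarith
      then show ?thesis
        using \<delta> by (simp add: field_simps)
    qed
    then have "norm (F z) * norm (L z) \<le> norm (F z) * (1 / \<delta> * exp (\<delta> * norm (L z)))" for z
      by (rule mult_left_mono) simp
    then show "AE z in M. norm (F z * L z) \<le> norm (1 / \<delta> * (norm (F z) * exp (\<delta> * norm (L z))))"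
      using \<delta> by (simp add: norm_mult mult.left_commute)
  qed measurable
  have bound: "norm ((\<integral>z. F z * exp (of_real h * L z) \<partial>M) - ((\<integral>z. F z \<partial>M) + h *\<^sub>R (\<integral>z. F z * L z \<partial>M))) \<le> C * h\<^sup>2"
    if h: "\<bar>h\<bar> \<le> \<delta> / 2" for h
  proof -
    have pt: "norm (F z * (exp (of_real h * L z) - (1 + of_real h * L z)))
        \<le> 8 / \<delta>\<^sup>2 * h\<^sup>2 * (norm (F z) * exp (\<delta> * norm (L z)))" for z
    proof -
      let ?x = "\<delta> / 2 * norm (L z)"
      have "norm (exp (of_real h * L z) - (1 + of_real h * L z))
          \<le> exp \<bar>Re (of_real h * L z)\<bar> * (norm (of_real h * L z))\<^sup>2"
        using Taylor_exp[of "of_real h * L z" 1] by (simp add: eval_nat_numeral)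
      also have "\<dots> \<le> exp ?x * (norm (of_real h * L z))\<^sup>2"
      proof -
        have "\<bar>Re (of_real h * L z)\<bar> \<le> norm (of_real h * L z)"
          by (rule abs_Re_le_cmod)
        also have "\<dots> \<le> ?x"
          using h by (simp add: norm_mult mult_right_mono del: times_divide_eq_left)
        finally show ?thesis
          by (intro mult_right_mono) auto
      qed
      also have "\<dots> = exp ?x * h\<^sup>2 * (8 / \<delta>\<^sup>2 * (?x\<^sup>2 / 2))"
        using \<delta> by (simp add: norm_mult field_simps power2_eq_square)
      also have "\<dots> \<le> exp ?x * h\<^sup>2 * (8 / \<delta>\<^sup>2 * exp ?x)"
      proof -
        have "?x\<^sup>2 / 2 \<le> exp ?x"
          using exp_lower_Taylor_quadratic[of ?x] \<delta> by (smt (verit) mult_nonneg_nonneg norm_ge_zero half_gt_zero_iff)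
        then show ?thesis
          by (intro mult_left_mono) auto
      qed
      also have "\<dots> = 8 / \<delta>\<^sup>2 * h\<^sup>2 * exp (\<delta> * norm (L z))"
        by (simp add: exp_add[symmetric] mult.left_commute[of "exp _"] mult.commute mult.assoc)
      finally have *: "norm (exp (of_real h * L z) - (1 + of_real h * L z))
          \<le> 8 / \<delta>\<^sup>2 * h\<^sup>2 * exp (\<delta> * norm (L z))" .
      show ?thesis
        using mult_left_mono[OF *, of "norm (F z)"] by (simp add: norm_mult mult_ac)
    qed
    have inth: "integrable M (\<lambda>z. F z * exp (of_real h * L z))"
      using h \<delta> by (intro intx) auto
    have "(\<integral>z. F z * exp (of_real h * L z) \<partial>M) - ((\<integral>z. F z \<partial>M) + h *\<^sub>R (\<integral>z. F z * L z \<partial>M))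
        = (\<integral>z. F z * exp (of_real h * L z) - (F z + of_real h * (F z * L z)) \<partial>M)"
      using inth int0 int1 by (simp add: scaleR_conv_of_real)
    also have "\<dots> = (\<integral>z. F z * (exp (of_real h * L z) - (1 + of_real h * L z)) \<partial>M)"
      by (simp add: algebra_simps)
    also have "norm \<dots> \<le> (\<integral>z. norm (F z * (exp (of_real h * L z) - (1 + of_real h * L z))) \<partial>M)"
      by (rule integral_norm_bound)
    also have "\<dots> \<le> (\<integral>z. 8 / \<delta>\<^sup>2 * h\<^sup>2 * (norm (F z) * exp (\<delta> * norm (L z))) \<partial>M)"
      using int by (intro integral_mono' pt integrable_mult_right) auto
    also have "\<dots> = C * h\<^sup>2"
      by (simp add: C_def I_def)
    finally show ?thesis .
  qed
  let ?G = "\<lambda>x. \<integral>z. F z * exp (of_real (x - a) * L z) \<partial>M"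
  show ?thesis
    unfolding has_vector_derivative_def has_derivative_within
  proof (intro conjI bounded_linear_scaleR_left)
    show "((\<lambda>y. (1 / norm (y - a)) *\<^sub>R (?G y - (?G a + (y - a) *\<^sub>R (\<integral>z. F z * L z \<partial>M)))) \<longlongrightarrow> 0) (at a)"
    proof (rule Lim_null_comparison)
      show "((\<lambda>y. C * \<bar>y - a\<bar>) \<longlongrightarrow> 0) (at a)"
        by (auto intro!: tendsto_eq_intros)
      have "\<forall>\<^sub>F y in at a. dist y a < \<delta> / 2 \<and> y \<noteq> a"
        unfolding eventually_at using \<delta> by (intro exI[of _ "\<delta> / 2"]) auto
      then show "\<forall>\<^sub>F y in at a. norm ((1 / norm (y - a)) *\<^sub>R (?G y - (?G a + (y - a) *\<^sub>R (\<integral>z. F z * L z \<partial>M)))) \<le> C * \<bar>y - a\<bar>"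
      proof eventually_elim
        case (elim y)
        then have "norm (?G y - (?G a + (y - a) *\<^sub>R (\<integral>z. F z * L z \<partial>M))) \<le> C * \<bar>y - a\<bar> * \<bar>y - a\<bar>"
          using bound[of "y - a"] by (simp add: dist_real_def power2_eq_square mult.assoc)
        then show ?case
          using elim by (simp add: divide_le_eq)
      qed
    qed
  qed
qed

text \<open>Completing the square bounds K|z| by c|z|^2 / 2 + K^2 / (2c), so linear growth costs
  half of the Gaussian. Then |g| \<le> |g|^q + 1 splits the rest into two integrable terms.\<close>

lemma integrable_Lp_gaussian:
  fixes g :: "complex \<Rightarrow> complex"
  assumes g [measurable]: "g \<in> borel_measurable borel" and q: "1 \<le> q"
    and int: "integrable lborel (\<lambda>z. norm (g z) powr q)"
    and c: "0 < c"
  shows "integrable lborel (\<lambda>z. norm (g z) * exp (- c * (norm z)\<^sup>2 + K * norm z))"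
proof (rule Bochner_Integration.integrable_bound)
  let ?C = "exp (K\<^sup>2 / (2 * c))"
  show "integrable lborel (\<lambda>z. ?C * (norm (g z) powr q + exp (- (c / 2) * (norm z)\<^sup>2)))"
    using int c by (intro integrable_mult_right Bochner_Integration.integrable_add integrable_exp_neg_norm_sq) auto
  have "norm (g z) * exp (- c * (norm z)\<^sup>2 + K * norm z) \<le> ?C * (norm (g z) powr q + exp (- (c / 2) * (norm z)\<^sup>2))" for z
  proof -
    let ?e = "exp (- (c / 2) * (norm z)\<^sup>2)"
    have "0 \<le> (K - c * norm z)\<^sup>2 / (2 * c)"
      using c by simp
    also have "\<dots> = K\<^sup>2 / (2 * c) - K * norm z + c / 2 * (norm z)\<^sup>2"
      using c by (simp add: power2_diff power2_eq_square field_simps)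
    finally have "exp (- c * (norm z)\<^sup>2 + K * norm z) \<le> ?C * ?e"
      by (simp add: exp_add[symmetric])
    then have "norm (g z) * exp (- c * (norm z)\<^sup>2 + K * norm z) \<le> ?C * (norm (g z) * ?e)"
      using mult_left_mono[of _ _ "norm (g z)"] by (simp add: mult.left_commute)
    also have "norm (g z) * ?e \<le> (norm (g z) powr q + 1) * ?e"
    proof (intro mult_right_mono)
      show "norm (g z) \<le> norm (g z) powr q + 1"
        using q powr_mono[of 1 q "norm (g z)"] by (cases "norm (g z) \<le> 1") (auto intro: add_increasing)
    qed simp
    also have "\<dots> \<le> norm (g z) powr q + ?e"
      using c by (simp add: distrib_right mult_left_le)
    finally show ?thesis by simp
  qed
  then show "AE z in lborel. norm (norm (g z) * exp (- c * (norm z)\<^sup>2 + K * norm z))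
      \<le> norm (?C * (norm (g z) powr q + exp (- (c / 2) * (norm z)\<^sup>2)))"
    by (simp add: add_nonneg_nonneg)
qed measurable

section \<open>Gaussian moments\<close>

lemma power_norm_le_exp: "norm (w :: 'b::real_normed_div_algebra) ^ n \<le> exp (real n * norm w)"
proof -
  have "norm w ^ n \<le> exp (norm w) ^ n"
  proof (rule power_mono)
    show "norm w \<le> exp (norm w)"
      using exp_ge_add_one_self[of "norm w"] by linarith
  qed simp
  then show ?thesis by (simp add: exp_of_nat_mult)
qed

text \<open>What the moment argument uses of membership in L^q. Allowing every \<open>K\<close>
  makes the class of weights stable under polynomial and linear exponential factors.\<close>

locale gaussian_integrable =
  fixes g :: "complex \<Rightarrow> complex"
  assumes borel_g [measurable]: "g \<in> borel_measurable borel"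
    and integrable_weight:
      "\<And>c K :: real. 0 < c \<Longrightarrow> integrable lborel (\<lambda>z. norm (g z) * exp (- c * (norm z)\<^sup>2 + K * norm z))"
begin

lemma integrable_dominated:
  fixes h :: "complex \<Rightarrow> complex"
  assumes [measurable]: "h \<in> borel_measurable borel" and "0 < c"
    and "\<And>z. norm (h z) \<le> exp (- c * (norm z)\<^sup>2 + K * norm z)"
  shows "integrable lborel (\<lambda>z. g z * h z)"
  using integrable_weight[OF assms(2), of K]
proof (rule Bochner_Integration.integrable_bound)
  show "AE z in lborel. norm (g z * h z) \<le> norm (norm (g z) * exp (- c * (norm z)\<^sup>2 + K * norm z))"
    using assms(3) by (simp add: norm_mult mult_left_mono)
qed measurable

text \<open>Each derivative in \<open>x\<close> of a vanishing integral brings down one factor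
  \<open>L\<close>. Keeping \<open>x\<close> arbitrary lets the induction differentiate again; at x
  = 0 the powers of \<open>L\<close> remain.\<close>

lemma gaussian_exp_power_eq_0:
  fixes a b :: complex and t x :: real
  defines "L \<equiv> \<lambda>z. a * z + b * cnj z"
  assumes t: "0 < t"
    and zero: "\<And>x::real. (\<integral>z. g z * (exp (- of_real (t * (norm z)\<^sup>2)) * exp (of_real x * L z)) \<partial>lborel) = 0"
  shows "(\<integral>z. g z * (exp (- of_real (t * (norm z)\<^sup>2)) * L z ^ n * exp (of_real x * L z)) \<partial>lborel) = 0"
proof (induction n arbitrary: x)
  case 0
  then show ?case using zero by simp
next
  case (Suc n)
  have [measurable]: "L \<in> borel_measurable borel"
    unfolding L_def by measurable
  let ?F = "\<lambda>z. g z * (exp (- of_real (t * (norm z)\<^sup>2)) * L z ^ n * exp (of_real x * L z))"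
  define M where "M = norm a + norm b"
  have L: "norm (L z) \<le> M * norm z" for z
    unfolding L_def M_def by (rule order_trans[OF norm_triangle_ineq]) (simp add: norm_mult distrib_right)
  have "integrable lborel (\<lambda>z. g z * (exp (- of_real (t * (norm z)\<^sup>2)) * L z ^ n * exp (of_real x * L z) * of_real (exp (1 * norm (L z)))))"
  proof (rule integrable_dominated[OF _ t])
    fix z
    have "norm (exp (- of_real (t * (norm z)\<^sup>2)) * L z ^ n * exp (of_real x * L z) * complex_of_real (exp (1 * norm (L z))))
        \<le> exp (- (t * (norm z)\<^sup>2)) * exp (real n * norm (L z)) * exp (\<bar>x\<bar> * norm (L z)) * exp (norm (L z))"
      unfolding norm_mult
    proof (intro mult_mono)
      show "norm (exp (of_real x * L z)) \<le> exp (\<bar>x\<bar> * norm (L z))"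
        using norm_exp[of "of_real x * L z"] by (simp add: norm_mult)
      show "norm (L z ^ n) \<le> exp (real n * norm (L z))"
        using power_norm_le_exp[of "L z" n] by (simp add: norm_power)
    qed auto
    also have "\<dots> = exp (- (t * (norm z)\<^sup>2) + (real n + \<bar>x\<bar> + 1) * norm (L z))"
      by (simp add: exp_add[symmetric] algebra_simps)
    also have "\<dots> \<le> exp (- t * (norm z)\<^sup>2 + ((real n + \<bar>x\<bar> + 1) * M) * norm z)"
      using mult_left_mono[OF L, of "real n + \<bar>x\<bar> + 1"] by (simp add: mult.assoc)
    finally show "norm (exp (- of_real (t * (norm z)\<^sup>2)) * L z ^ n * exp (of_real x * L z) * complex_of_real (exp (1 * norm (L z))))
      \<le> exp (- t * (norm z)\<^sup>2 + ((real n + \<bar>x\<bar> + 1) * M) * norm z)" .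
  qed measurable
  from integrable_norm[OF this]
  have "integrable lborel (\<lambda>z. norm (?F z) * exp (1 * norm (L z)))"
    by (simp add: norm_mult mult.assoc)
  from has_vector_derivative_integral_exp[OF _ _ zero_less_one this, of x]
  have "((\<lambda>y. \<integral>z. ?F z * exp (of_real (y - x) * L z) \<partial>lborel) has_vector_derivative
      (\<integral>z. ?F z * L z \<partial>lborel)) (at x)"
    by simp
  moreover have "(\<integral>z. ?F z * exp (of_real (y - x) * L z) \<partial>lborel) = 0" for y
  proof -
    have "exp (of_real x * L z) * exp (of_real (y - x) * L z) = exp (of_real y * L z)" for z
      by (simp add: exp_add[symmetric] algebra_simps)
    then have "?F z * exp (of_real (y - x) * L z)
        = g z * (exp (- of_real (t * (norm z)\<^sup>2)) * L z ^ n * exp (of_real y * L z))" for z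
      by (simp only: mult.assoc)
    then show ?thesis
      using Suc.IH[of y] by (simp only:)
  qed
  ultimately have "((\<lambda>y. 0) has_vector_derivative (\<integral>z. ?F z * L z \<partial>lborel)) (at x)"
    by (simp only:)
  then have "(\<integral>z. ?F z * L z \<partial>lborel) = 0"
    by (rule vector_derivative_unique_at[OF _ has_vector_derivative_const])
  then show ?case
    by (simp add: mult_ac)
qed

section \<open>Moments and their dependence on \<open>t\<close>\<close>

definition moment :: "nat \<Rightarrow> nat \<Rightarrow> real \<Rightarrow> complex" where
  "moment j k t = (\<integral>z. g z * (exp (- of_real (t * (norm z)\<^sup>2)) * z ^ j * cnj z ^ k) \<partial>lborel)"

lemma moment_norm_bound:
  "norm (exp (- of_real (t * (norm z)\<^sup>2)) * z ^ j * cnj z ^ k)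
    \<le> exp (- t * (norm z)\<^sup>2 + real (j + k) * norm z)"
proof -
  have "norm (exp (- of_real (t * (norm z)\<^sup>2)) * z ^ j * cnj z ^ k) = exp (- (t * (norm z)\<^sup>2)) * norm z ^ (j + k)"
    by (simp add: norm_mult norm_power power_add)
  also have "\<dots> \<le> exp (- (t * (norm z)\<^sup>2)) * exp (real (j + k) * norm z)"
    using power_norm_le_exp[of z "j + k"] by (intro mult_left_mono) auto
  finally show ?thesis by (simp add: exp_add[symmetric])
qed

lemma integrable_moment:
  "0 < t \<Longrightarrow> integrable lborel (\<lambda>z. g z * (exp (- of_real (t * (norm z)\<^sup>2)) * z ^ j * cnj z ^ k))"
  by (rule integrable_dominated[OF _ _ moment_norm_bound]) measurable

text \<open>Differentiating exp(-t|z|^2) brings down -|z|^2 = -z z*, which raises both indices by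
  one.\<close>

lemma moment_has_vector_derivative:
  assumes t: "0 < t"
  shows "(moment j k has_vector_derivative - moment (Suc j) (Suc k) t) (at t)"
proof -
  let ?F = "\<lambda>z. g z * (exp (- of_real (t * (norm z)\<^sup>2)) * z ^ j * cnj z ^ k)"
  let ?L = "\<lambda>z. - complex_of_real ((norm z)\<^sup>2)"
  \<comment> \<open>Half of the Gaussian secures integrability; the other half is the spare
    exponential, whence \<delta> = t / 2.\<close>
  have "integrable lborel (\<lambda>z. g z * (exp (- of_real (t / 2 * (norm z)\<^sup>2)) * z ^ j * cnj z ^ k))"
    using t by (intro integrable_moment) simp
  from integrable_norm[OF this]
  have "integrable lborel (\<lambda>z. norm (?F z) * exp (t / 2 * norm (?L z)))"
  proof (rule Bochner_Integration.integrable_cong[OF refl, THEN iffD1, rotated])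
    fix z :: complex
    have "exp (- (t / 2 * (norm z)\<^sup>2)) = exp (- (t * (norm z)\<^sup>2)) * exp (t / 2 * (norm z)\<^sup>2)"
      by (simp add: exp_add[symmetric])
    then show "norm (g z * (exp (- of_real (t / 2 * (norm z)\<^sup>2)) * z ^ j * cnj z ^ k)) = norm (?F z) * exp (t / 2 * norm (?L z))"
      by (simp add: norm_mult norm_power mult_ac)
  qed
  from has_vector_derivative_integral_exp[OF _ _ half_gt_zero[OF t] this, of t]
  have "((\<lambda>s. \<integral>z. ?F z * exp (of_real (s - t) * ?L z) \<partial>lborel) has_vector_derivative
      (\<integral>z. ?F z * ?L z \<partial>lborel)) (at t)"
    by simp
  moreover have "(\<lambda>s. \<integral>z. ?F z * exp (of_real (s - t) * ?L z) \<partial>lborel) = moment j k"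
  proof (rule ext)
    fix s
    have "exp (- complex_of_real (t * (norm z)\<^sup>2)) * exp (of_real (s - t) * ?L z) = exp (- of_real (s * (norm z)\<^sup>2))" for z
      by (simp add: exp_add[symmetric] algebra_simps)
    from arg_cong[OF this, of "\<lambda>w. g z * z ^ j * cnj z ^ k * w" for z]
    have "?F z * exp (of_real (s - t) * ?L z) = g z * (exp (- of_real (s * (norm z)\<^sup>2)) * z ^ j * cnj z ^ k)" for z
      by (simp only: mult_ac)
    then show "(\<integral>z. ?F z * exp (of_real (s - t) * ?L z) \<partial>lborel) = moment j k s"
      by (simp only: moment_def)
  qed
  moreover have "(\<integral>z. ?F z * ?L z \<partial>lborel) = - moment (Suc j) (Suc k) t"
  proof -
    have "?F z * ?L z = - (g z * (exp (- of_real (t * (norm z)\<^sup>2)) * z ^ Suc j * cnj z ^ Suc k))" for z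
      unfolding complex_norm_square power_Suc by (simp add: algebra_simps)
    then show ?thesis
      by (simp only: moment_def integral_minus)
  qed
  ultimately show ?thesis by simp
qed

text \<open>Vanishing at a single \<open>t\<close> would say nothing about the derivative, hence the
  open half-line above \<open>T\<close>.\<close>

lemma moment_Suc_Suc_eq_0:
  assumes "0 \<le> T" and zero: "\<And>t. T < t \<Longrightarrow> moment j k t = 0" and t: "T < t"
  shows "moment (Suc j) (Suc k) t = 0"
proof -
  have "(moment j k has_vector_derivative - moment (Suc j) (Suc k) t) (at t)"
    using assms by (intro moment_has_vector_derivative) simp
  then have "((\<lambda>_. 0) has_vector_derivative - moment (Suc j) (Suc k) t) (at t)"
    by (rule has_vector_derivative_transform_within_open[where S = "{T<..}"]) (use zero t in auto)
  then have "- moment (Suc j) (Suc k) t = 0"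
    by (rule vector_derivative_unique_at[OF _ has_vector_derivative_const])
  then show ?thesis by simp
qed

lemma moment_add_add_eq_0:
  assumes "0 \<le> T" and "\<And>t. T < t \<Longrightarrow> moment j k t = 0" and "T < t"
  shows "moment (j + p) (k + p) t = 0"
  using assms(3)
proof (induction p arbitrary: t)
  case (Suc p)
  then show ?case
    using moment_Suc_Suc_eq_0[OF assms(1), of "j + p" "k + p"] by simp
qed (simp add: assms)

lemma integral_binomial_eq_sum_moment:
  assumes t: "0 < t"
  shows "(\<integral>z. g z * (exp (- of_real (t * (norm z)\<^sup>2)) * (a * z + b * cnj z) ^ n) \<partial>lborel)
    = (\<Sum>k\<le>n. of_nat (n choose k) * b ^ k * a ^ (n - k) * moment (n - k) k t)"
proof -
  let ?m = "\<lambda>k z. g z * (exp (- of_real (t * (norm z)\<^sup>2)) * z ^ (n - k) * cnj z ^ k)"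
  have "(\<Sum>k\<le>n. of_nat (n choose k) * b ^ k * a ^ (n - k) * ?m k z)
      = g z * (exp (- of_real (t * (norm z)\<^sup>2)) * (a * z + b * cnj z) ^ n)" for z
    by (subst add.commute[of "a * z"], subst binomial_ring)
      (simp add: sum_distrib_left power_mult_distrib mult_ac)
  then have "(\<integral>z. g z * (exp (- of_real (t * (norm z)\<^sup>2)) * (a * z + b * cnj z) ^ n) \<partial>lborel)
      = (\<integral>z. (\<Sum>k\<le>n. of_nat (n choose k) * b ^ k * a ^ (n - k) * ?m k z) \<partial>lborel)"
    by simp
  also have "\<dots> = (\<Sum>k\<le>n. \<integral>z. of_nat (n choose k) * b ^ k * a ^ (n - k) * ?m k z \<partial>lborel)"
    by (intro Bochner_Integration.integral_sum integrable_mult_right integrable_moment t)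
  also have "\<dots> = (\<Sum>k\<le>n. of_nat (n choose k) * b ^ k * a ^ (n - k) * moment (n - k) k t)"
    by (simp only: moment_def integral_mult_right_zero)
  finally show ?thesis .
qed

text \<open>
  By induction on \<open>n\<close>, the edge moments \<open>(n, 0)\<close> and \<open>(0, n)\<close> vanish; the others follow by
  differentiating in \<open>t\<close>, which raises both indices. The two signs separate even from odd
  \<open>k\<close>. For odd \<open>n\<close> the edge moments sit in different parities. For even \<open>n\<close> level \<open>n\<close> gives
  only \<open>A\<^sup>n G + B\<^sup>n H = 0\<close>, while the odd part of level \<open>n + 2\<close> gives \<open>A\<^sup>n G' + B\<^sup>n H' = 0\<close>; since
  \<open>A' = B' \<noteq> 0\<close>, differentiating the first yields the independent relation
  \<open>A\<^sup>n\<^sup>-\<^sup>1 G + B\<^sup>n\<^sup>-\<^sup>1 H = 0\<close>.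
\<close>

lemma moments_eq_0:
  assumes zero: "\<And>n t \<sigma>. 1 / 4 < t \<Longrightarrow> \<sigma> \<in> {1, -1} \<Longrightarrow>
      (\<integral>z. g z * (exp (- of_real (t * (norm z)\<^sup>2))
        * (of_real (4 * t + 1) * z + \<sigma> * of_real (4 * t - 1) * cnj z) ^ n) \<partial>lborel) = 0"
    and "1 / 4 < t"
  shows "moment j k t = 0"
proof -
  have add_diff_0: "x = 0 \<and> y = 0" if "x + y = 0" "x - y = 0" for x y :: complex
    using that by (simp add: complex_eq_iff)
  define A B where "A = (\<lambda>t::real. 4 * t + 1)" and "B = (\<lambda>t::real. 4 * t - 1)"
  have sum0: "(\<Sum>k\<le>n. of_nat (n choose k) * (\<sigma> * of_real (B t)) ^ k * of_real (A t) ^ (n - k) * moment (n - k) k t) = 0"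
    if "1 / 4 < t" "\<sigma> \<in> {1, -1}" for n t \<sigma>
    using zero[OF that, of n] that integral_binomial_eq_sum_moment[of t "of_real (A t)" "\<sigma> * of_real (B t)" n]
    by (simp add: A_def B_def)
  have pos: "0 < A t" "0 < B t" if "1 / 4 < t" for t
    using that by (simp_all add: A_def B_def)
  \<comment> \<open>The two inequalities say |j - k| < n: such a moment is, up to sign, a derivative
    in \<open>t\<close> of the edge moment of index |j - k|.\<close>
  have diag: "moment j k t = 0"
    if edge: "\<And>m t. m < n \<Longrightarrow> 1 / 4 < t \<Longrightarrow> moment m 0 t = 0 \<and> moment 0 m t = 0"
      and "j < k + n" "k < j + n" "1 / 4 < t" for n j k t
  proof (cases "k \<le> j")
    case True
    then show ?thesis
      using moment_add_add_eq_0[of "1 / 4" "j - k" 0 t k] edge[of "j - k"] that by auto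
  next
    case False
    then show ?thesis
      using moment_add_add_eq_0[of "1 / 4" 0 "k - j" t j] edge[of "k - j"] that by auto
  qed
  have edge: "1 / 4 < t \<Longrightarrow> moment n 0 t = 0 \<and> moment 0 n t = 0" for n t
  proof (induction n arbitrary: t rule: less_induct)
    case (less n)
    note IH = diag[where n = n, OF less.IH]
    have two: "of_real (A t) ^ n * moment n 0 t + (\<sigma> * of_real (B t)) ^ n * moment 0 n t = 0"
      if n: "0 < n" and t: "1 / 4 < t" and \<sigma>: "\<sigma> \<in> {1, -1}" for t \<sigma>
    proof -
      have "(\<Sum>k\<in>{0, n}. of_nat (n choose k) * (\<sigma> * of_real (B t)) ^ k * of_real (A t) ^ (n - k) * moment (n - k) k t) = 0"
        unfolding sum0[OF t \<sigma>, of n, symmetric]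
        by (rule sum.mono_neutral_left) (auto intro!: IH t)
      then show ?thesis using n by simp
    qed
    consider "n = 0" | "odd n" | "even n" "0 < n" by blast
    then show ?case
    proof cases
      case 1
      then show ?thesis using sum0[OF less.prems, of 1 0] by simp
    next
      case 2
      then have "0 < n" by (rule odd_pos)
      from two[OF this less.prems, of 1] two[OF this less.prems, of "-1"] 2
      have "of_real (A t) ^ n * moment n 0 t + of_real (B t) ^ n * moment 0 n t = 0"
        "of_real (A t) ^ n * moment n 0 t - of_real (B t) ^ n * moment 0 n t = 0"
        by simp_all
      then have "of_real (A t) ^ n * moment n 0 t = 0" "of_real (B t) ^ n * moment 0 n t = 0"
        by (rule add_diff_0[THEN conjunct1], rule add_diff_0[THEN conjunct2])
      then show ?thesis
        using pos[OF less.prems] by simp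
    next
      case 3
      have rel: "A t ^ n *\<^sub>R moment n 0 t + B t ^ n *\<^sub>R moment 0 n t = 0" if "1 / 4 < t" for t
        using two[OF 3(2) that, of 1] by (simp add: scaleR_conv_of_real)
      have rel': "A t ^ n *\<^sub>R moment (Suc n) 1 t + B t ^ n *\<^sub>R moment 1 (Suc n) t = 0"
      proof -
        let ?c = "\<lambda>\<sigma> k. of_nat (Suc (Suc n) choose k) * (\<sigma> * of_real (B t)) ^ k * of_real (A t) ^ (Suc (Suc n) - k)
          * moment (Suc (Suc n) - k) k t"
        \<comment> \<open>In degree n + 2 the moment with index k has index difference |n + 2 - 2k|,
          which is below n exactly for 2 \<le> k \<le> n. Four terms survive.\<close>
        have S0: "(\<Sum>k\<in>{0, 1, Suc n, Suc (Suc n)}. ?c \<sigma> k) = 0" if "\<sigma> \<in> {1, -1}" for \<sigma>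
          unfolding sum0[OF less.prems that, of "Suc (Suc n)", symmetric]
          by (rule sum.mono_neutral_left) (auto intro!: IH less.prems)
        \<comment> \<open>Since \<open>n\<close> is even and positive, the four indices are
          distinct; k = 0 and k = n + 2 form the part \<open>?X\<close> free of \<sigma>, while k =
          1 and k = n + 1 carry \<sigma> and share the factor (n + 2) A B, giving
          \<open>?Y\<close>.\<close>
        let ?X = "of_real (A t) ^ (n + 2) * moment (n + 2) 0 t + of_real (B t) ^ (n + 2) * moment 0 (n + 2) t"
        let ?Y = "of_nat (n + 2) * (of_real (A t * B t) * (A t ^ n *\<^sub>R moment (Suc n) 1 t + B t ^ n *\<^sub>R moment 1 (Suc n) t))"
        have S1: "(\<Sum>k\<in>{0, 1, Suc n, Suc (Suc n)}. ?c \<sigma> k) = ?X + \<sigma> * ?Y" if "\<sigma> \<in> {1, -1}" for \<sigma>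
        proof -
          have "Suc (Suc n) choose Suc n = n + 2"
            using binomial_symmetric[of "Suc n" "Suc (Suc n)"] by simp
          then have ch: "of_nat (Suc (Suc n) choose Suc n) = (of_nat (n + 2) :: complex)"
            by (simp only:)
          have s: "\<sigma> ^ Suc n = \<sigma>" "\<sigma> ^ Suc (Suc n) = 1"
            using that 3 by auto
          have sum4: "(\<Sum>k\<in>{0, 1, Suc n, Suc (Suc n)}. f k) = f 0 + (f 1 + (f (Suc n) + f (Suc (Suc n))))"
            for f :: "nat \<Rightarrow> complex"
            using 3 by simp
          have "(\<Sum>k\<in>{0, 1, Suc n, Suc (Suc n)}. ?c \<sigma> k) = ?c \<sigma> 0 + (?c \<sigma> 1 + (?c \<sigma> (Suc n) + ?c \<sigma> (Suc (Suc n))))"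
            by (rule sum4)
          also have "?c \<sigma> 0 = of_real (A t) ^ (n + 2) * moment (n + 2) 0 t"
            by simp
          also have "?c \<sigma> 1 = \<sigma> * (of_nat (n + 2) * (of_real (A t * B t) * (A t ^ n *\<^sub>R moment (Suc n) 1 t)))"
            by (simp add: scaleR_conv_of_real)
          also have "?c \<sigma> (Suc n) = \<sigma> * (of_nat (n + 2) * (of_real (A t * B t) * (B t ^ n *\<^sub>R moment 1 (Suc n) t)))"
            unfolding ch power_mult_distrib s by (simp add: scaleR_conv_of_real)
          also have "?c \<sigma> (Suc (Suc n)) = of_real (B t) ^ (n + 2) * moment 0 (n + 2) t"
            unfolding power_mult_distrib s by simp
          also have "x + (\<sigma> * (c * (d * u)) + (\<sigma> * (c * (d * v)) + y)) = x + y + \<sigma> * (c * (d * (u + v)))"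
            for x y c d u v :: complex
            by (simp add: distrib_left)
          finally show ?thesis .
        qed
        have XY: "?X + \<sigma> * ?Y = 0" if "\<sigma> \<in> {1, -1}" for \<sigma>
          by (rule trans[OF S1[OF that, symmetric] S0[OF that]])
        have "?X + ?Y = 0"
          using XY[of 1] by (simp only: mult_1 insertI1)
        moreover have "?X - ?Y = 0"
          using XY[of "-1"] by (simp only: insertI1 insertI2 mult_minus1 diff_conv_add_uminus)
        ultimately have "?Y = 0"
          by (rule add_diff_0[THEN conjunct2])
        moreover have "of_nat (n + 2) \<noteq> (0 :: complex)"
          unfolding of_nat_eq_0_iff by simp
        ultimately show ?thesis
          using pos[OF less.prems] by (simp del: of_nat_add)
      qed
      have d: "((\<lambda>t. A t ^ n *\<^sub>R moment n 0 t + B t ^ n *\<^sub>R moment 0 n t) has_vector_derivative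
          (A t ^ n *\<^sub>R - moment (Suc n) 1 t + (4 * real n * A t ^ (n - 1)) *\<^sub>R moment n 0 t)
          + (B t ^ n *\<^sub>R - moment 1 (Suc n) t + (4 * real n * B t ^ (n - 1)) *\<^sub>R moment 0 n t)) (at t)"
        using moment_has_vector_derivative[of t n 0] moment_has_vector_derivative[of t 0 n] less.prems
        by (intro has_vector_derivative_add has_vector_derivative_scaleR)
          (auto simp: A_def B_def intro!: derivative_eq_intros)
      then have "((\<lambda>_. 0) has_vector_derivative
          (A t ^ n *\<^sub>R - moment (Suc n) 1 t + (4 * real n * A t ^ (n - 1)) *\<^sub>R moment n 0 t)
          + (B t ^ n *\<^sub>R - moment 1 (Suc n) t + (4 * real n * B t ^ (n - 1)) *\<^sub>R moment 0 n t)) (at t)"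
        by (rule has_vector_derivative_transform_within_open[where S = "{1 / 4<..}"]) (use rel less.prems in auto)
      then have "(A t ^ n *\<^sub>R - moment (Suc n) 1 t + (4 * real n * A t ^ (n - 1)) *\<^sub>R moment n 0 t)
          + (B t ^ n *\<^sub>R - moment 1 (Suc n) t + (4 * real n * B t ^ (n - 1)) *\<^sub>R moment 0 n t) = 0"
        by (rule vector_derivative_unique_at[OF _ has_vector_derivative_const])
      moreover have "(a *\<^sub>R - u + (c * a') *\<^sub>R v) + (b *\<^sub>R - u' + (c * b') *\<^sub>R v')
          = c *\<^sub>R (a' *\<^sub>R v + b' *\<^sub>R v') - (a *\<^sub>R u + b *\<^sub>R u')" for a b c a' b' and u v u' v' :: complex
        by (simp add: algebra_simps)
      ultimately have "(4 * real n) *\<^sub>R (A t ^ (n - 1) *\<^sub>R moment n 0 t + B t ^ (n - 1) *\<^sub>R moment 0 n t) = 0"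
        by (simp only: rel' diff_zero)
      then have low: "A t ^ (n - 1) *\<^sub>R moment n 0 t + B t ^ (n - 1) *\<^sub>R moment 0 n t = 0"
        using 3 by simp
      \<comment> \<open>The factor 2 is A - B, the trace of the twist: multiplying the lower
        relation by A and subtracting the original one eliminates
        \<open>moment n 0 t\<close>.\<close>
      have "(2 * B t ^ (n - 1)) *\<^sub>R moment 0 n t
          = A t *\<^sub>R (A t ^ (n - 1) *\<^sub>R moment n 0 t + B t ^ (n - 1) *\<^sub>R moment 0 n t)
            - (A t ^ n *\<^sub>R moment n 0 t + B t ^ n *\<^sub>R moment 0 n t)"
      proof -
        have "A t ^ n = A t * A t ^ (n - 1)" "B t ^ n = B t * B t ^ (n - 1)"
          using 3 by (simp_all flip: power_Suc)
        moreover have "A t = B t + 2"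
          by (simp add: A_def B_def)
        ultimately show ?thesis
          by (simp add: algebra_simps scaleR_2)
      qed
      then have "moment 0 n t = 0"
        using low rel[OF less.prems] pos[OF less.prems] by simp
      then show ?thesis
        using low pos[OF less.prems] by simp
    qed
  qed
  show ?thesis
    \<comment> \<open>Any bound exceeding |j - k| serves here.\<close>
    using edge assms(2) by (intro diag[where n = "j + k + 1"]) auto
qed

section \<open>Determinacy by Gaussian moments\<close>

text \<open>
  An injective map of the plane into a compact set, so that Stone--Weierstrass applies to the
  polynomials in its components; the last component makes the inverse \<open>(w, s) \<mapsto> w / s\<close> Borel.
\<close>

definition gauss_embed :: "complex \<Rightarrow> complex \<times> real" where
  "gauss_embed z = (of_real (exp (- (norm z)\<^sup>2)) * z, exp (- (norm z)\<^sup>2))"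

text \<open>Integrated against g exp(-|z|^2), a monomial becomes a multiple of
  \<open>moment j k (m + 1)\<close>; the shift by one is why m = 0 is admissible.\<close>

inductive_set gauss_polys :: "(complex \<Rightarrow> complex) set" where
  monomial: "(\<lambda>z. c * (exp (- of_real (real m * (norm z)\<^sup>2)) * z ^ j * cnj z ^ k)) \<in> gauss_polys"
| add: "u \<in> gauss_polys \<Longrightarrow> v \<in> gauss_polys \<Longrightarrow> (\<lambda>z. u z + v z) \<in> gauss_polys"

lemma gauss_polys_scale: "v \<in> gauss_polys \<Longrightarrow> (\<lambda>z. v z * c) \<in> gauss_polys"
proof (induction rule: gauss_polys.induct)
  case (monomial d m j k)
  then show ?case
    using gauss_polys.monomial[of "d * c" m j k] by (simp add: mult_ac)
next
  case (add u v)
  from gauss_polys.add[OF add.IH] show ?case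
    by (simp only: distrib_right)
qed

text \<open>Both components of \<open>gauss_embed\<close> carry exactly one factor exp(-|z|^2), so a
  linear functional raises \<open>m\<close> by one and at most one of the exponents
  \<open>j\<close>, \<open>k\<close>.\<close>

lemma gauss_polys_mult_linear:
  fixes l :: "complex \<times> real \<Rightarrow> real"
  assumes l: "bounded_linear l" and v: "v \<in> gauss_polys"
  shows "(\<lambda>z. v z * of_real (l (gauss_embed z))) \<in> gauss_polys"
  using v
proof (induction rule: gauss_polys.induct)
  case (monomial c m j k)
  interpret l: bounded_linear l by (rule l)
  \<comment> \<open>Rewriting Re w and Im w through w and w* turns the real functional into l (w, s)
    = p w + q w* + r s.\<close>
  define p q r where "p = (of_real (l (1, 0)) - \<i> * of_real (l (\<i>, 0))) / 2"
    and "q = (of_real (l (1, 0)) + \<i> * of_real (l (\<i>, 0))) / 2" and "r = complex_of_real (l (0, 1))"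
  have dec: "(w, s) = Re w *\<^sub>R (1, 0) + Im w *\<^sub>R (\<i>, 0) + s *\<^sub>R (0, 1)" for w :: complex and s :: real
    by (simp add: complex_eq_iff)
  have lw: "l (w, s) = Re w * l (1, 0) + Im w * l (\<i>, 0) + s * l (0, 1)" for w s
    by (subst dec) (simp only: l.add l.scaleR real_scaleR_def)
  have lin: "of_real (l (gauss_embed z)) = exp (- of_real ((norm z)\<^sup>2)) * (p * z + q * cnj z + r)" for z
  proof -
    define E where "E = exp (- (norm z)\<^sup>2)"
    have "exp (- complex_of_real ((norm z)\<^sup>2)) = of_real E"
      unfolding E_def using exp_of_real[of "- (norm z)\<^sup>2", where 'a = complex] by simp
    moreover have "of_real (l (of_real E * z, E)) = of_real E * (p * z + q * cnj z + r)"
      unfolding lw[of "of_real E * z" E] p_def q_def r_def by (simp add: complex_eq_iff algebra_simps add_divide_distrib diff_divide_distrib)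
    ultimately show ?thesis
      by (simp only: gauss_embed_def E_def)
  qed
  have e: "exp (- complex_of_real (real (Suc m) * (norm z)\<^sup>2))
      = exp (- of_real (real m * (norm z)\<^sup>2)) * exp (- of_real ((norm z)\<^sup>2))" for z :: complex
    by (simp add: exp_add[symmetric] algebra_simps)
  note M = gauss_polys.monomial[where m = "Suc m"]
  have "(\<lambda>z. c * p * (exp (- of_real (real (Suc m) * (norm z)\<^sup>2)) * z ^ Suc j * cnj z ^ k)
      + c * q * (exp (- of_real (real (Suc m) * (norm z)\<^sup>2)) * z ^ j * cnj z ^ Suc k)
      + c * r * (exp (- of_real (real (Suc m) * (norm z)\<^sup>2)) * z ^ j * cnj z ^ k)) \<in> gauss_polys"
    by (rule gauss_polys.add[OF gauss_polys.add[OF M M] M])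
  also have "(\<lambda>z. c * p * (exp (- of_real (real (Suc m) * (norm z)\<^sup>2)) * z ^ Suc j * cnj z ^ k)
      + c * q * (exp (- of_real (real (Suc m) * (norm z)\<^sup>2)) * z ^ j * cnj z ^ Suc k)
      + c * r * (exp (- of_real (real (Suc m) * (norm z)\<^sup>2)) * z ^ j * cnj z ^ k))
    = (\<lambda>z. c * (exp (- of_real (real m * (norm z)\<^sup>2)) * z ^ j * cnj z ^ k) * of_real (l (gauss_embed z)))"
    unfolding lin e power_Suc by (intro ext) (simp only: distrib_left distrib_right mult_ac)
  finally show ?case .
next
  case (add u v)
  from gauss_polys.add[OF add.IH] show ?case
    by (simp only: distrib_right)
qed

lemma gauss_polys_mult_polynomial:
  assumes "real_polynomial_function P" and "v \<in> gauss_polys"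
  shows "(\<lambda>z. v z * of_real (P (gauss_embed z))) \<in> gauss_polys"
  using assms
proof (induction arbitrary: v rule: real_polynomial_function.induct)
  case (linear l)
  then show ?case by (rule gauss_polys_mult_linear)
next
  case (const c)
  then show ?case by (rule gauss_polys_scale)
next
  case (add P Q)
  from gauss_polys.add[OF add.IH(1)[OF add.prems] add.IH(2)[OF add.prems]]
  show ?case by (simp add: distrib_left)
next
  case (mult P Q)
  from mult.IH(2)[OF mult.IH(1)[OF mult.prems]]
  show ?case by (simp add: mult.assoc)
qed

section \<open>From vanishing moments to a function vanishing almost everywhere\<close>

lemma gauss_embed_measurable [measurable]: "gauss_embed \<in> borel_measurable borel"
  unfolding gauss_embed_def by measurable

lemma gauss_embed_in_cball: "gauss_embed z \<in> cball 0 2"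
proof -
  have "norm z \<le> exp ((norm z)\<^sup>2)"
  proof -
    have "norm z \<le> 1 + (norm z)\<^sup>2"
      using zero_le_power2[of "norm z - 1"] norm_ge_zero[of z] unfolding power2_diff power_one by linarith
    also have "\<dots> \<le> exp ((norm z)\<^sup>2)"
      by (rule exp_ge_add_one_self)
    finally show ?thesis .
  qed
  then have "norm (of_real (exp (- (norm z)\<^sup>2)) * z) \<le> 1"
    by (simp add: norm_mult norm_divide exp_minus divide_simps)
  moreover have "norm (exp (- (norm z)\<^sup>2)) \<le> 1"
    by simp
  ultimately have "norm (gauss_embed z) \<le> 2"
    unfolding gauss_embed_def using norm_Pair_le order_trans by (smt (verit, best))
  then show ?thesis by simp
qed

text \<open>The complex measure with density \<open>F\<close> is pushed forward by
  \<open>gauss_embed\<close> to a compact ball. There it annihilates polynomials, hence continuous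
  functions, closed sets and Borel sets, and injectivity carries this back to the plane.\<close>

lemma AE_eq_0_if_moments_eq_0:
  assumes zero: "\<And>j k t. 1 \<le> t \<Longrightarrow> moment j k t = 0"
  shows "AE z in lborel. g z = 0"
proof -
  \<comment> \<open>The Gaussian factor makes the density integrable, as \<open>g\<close> itself
    need not be.\<close>
  define F where "F = (\<lambda>z. g z * exp (- of_real ((norm z)\<^sup>2)))"
  have F_int: "integrable lborel F"
    using integrable_moment[of 1 0 0] by (simp add: F_def)
  have [measurable]: "F \<in> borel_measurable borel"
    unfolding F_def by measurable
  have polys: "integrable lborel (\<lambda>z. F z * v z) \<and> (\<integral>z. F z * v z \<partial>lborel) = 0" if "v \<in> gauss_polys" for v
    using that
  proof induction
    case (monomial c m j k)
    let ?h = "\<lambda>z. g z * (exp (- of_real (real (Suc m) * (norm z)\<^sup>2)) * z ^ j * cnj z ^ k)"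
    have "exp (- complex_of_real (real (Suc m) * (norm z)\<^sup>2))
        = exp (- of_real ((norm z)\<^sup>2)) * exp (- of_real (real m * (norm z)\<^sup>2))" for z :: complex
      by (simp add: exp_add[symmetric] algebra_simps)
    then have eq: "(\<lambda>z. F z * (c * (exp (- of_real (real m * (norm z)\<^sup>2)) * z ^ j * cnj z ^ k))) = (\<lambda>z. c * ?h z)"
      by (intro ext) (simp only: F_def mult_ac)
    have "integrable lborel ?h"
      by (rule integrable_moment) simp
    moreover have "(\<integral>z. ?h z \<partial>lborel) = 0"
      using zero[of "real (Suc m)" j k] by (simp add: moment_def)
    ultimately show ?case
      unfolding eq by simp
  next
    case (add u v)
    then show ?case by (simp add: distrib_left)
  qed
  have poly: "integrable lborel (\<lambda>z. F z * of_real (P (gauss_embed z)))"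
      "(\<integral>z. F z * of_real (P (gauss_embed z)) \<partial>lborel) = 0" if "real_polynomial_function P" for P
  proof -
    have "(\<lambda>z. 1) \<in> gauss_polys"
      using gauss_polys.monomial[of 1 0 0 0] by simp
    from polys[OF gauss_polys_mult_polynomial[OF that this]]
    show "integrable lborel (\<lambda>z. F z * of_real (P (gauss_embed z)))"
      "(\<integral>z. F z * of_real (P (gauss_embed z)) \<partial>lborel) = 0"
      by simp_all
  qed
  have bdd_int: "integrable lborel (\<lambda>z. F z * of_real (h (gauss_embed z)))"
    if [measurable]: "h \<in> borel_measurable borel" and "\<And>x. \<bar>h x\<bar> \<le> 1" for h :: "complex \<times> real \<Rightarrow> real"
    using F_int
  proof (rule Bochner_Integration.integrable_bound)
    show "AE z in lborel. norm (F z * of_real (h (gauss_embed z))) \<le> norm (F z)"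
      using that(2) by (simp add: norm_mult mult_left_le)
  qed measurable
  have cont: "(\<integral>z. F z * of_real (h (gauss_embed z)) \<partial>lborel) = 0"
    if h: "continuous_on UNIV h" and h1: "\<And>x. \<bar>h x\<bar> \<le> 1" for h :: "complex \<times> real \<Rightarrow> real"
  proof -
    have [measurable]: "h \<in> borel_measurable borel"
      using h by (rule borel_measurable_continuous_onI)
    have hi: "integrable lborel (\<lambda>z. F z * of_real (h (gauss_embed z)))"
      by (rule bdd_int) (use h1 in measurable)
    let ?I = "\<integral>z. norm (F z) \<partial>lborel"
    have small: "norm (\<integral>z. F z * of_real (h (gauss_embed z)) \<partial>lborel) \<le> e" if "0 < e" for e :: real
    proof -
      have I: "0 \<le> ?I" by simp
      \<comment> \<open>The added 1 keeps the quotient meaningful when the norm of \<open>F\<close>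
        integrates to 0.\<close>
      then have "0 < e / (?I + 1)"
        using that by (intro divide_pos_pos) linarith+
      then obtain P where P: "real_polynomial_function P"
        and hP: "\<And>x. x \<in> cball 0 2 \<Longrightarrow> \<bar>h x - P x\<bar> < e / (?I + 1)"
        using Stone_Weierstrass_real_polynomial_function[of "cball 0 2" h "e / (?I + 1)"]
          continuous_on_subset[OF h] by auto
      have "(\<integral>z. F z * of_real (h (gauss_embed z)) \<partial>lborel)
          = (\<integral>z. F z * of_real (h (gauss_embed z)) - F z * of_real (P (gauss_embed z)) \<partial>lborel)"
        using poly[OF P] hi by simp
      also have "norm \<dots> \<le> (\<integral>z. norm (F z * of_real (h (gauss_embed z)) - F z * of_real (P (gauss_embed z))) \<partial>lborel)"
        by (rule integral_norm_bound)
      also have "\<dots> \<le> (\<integral>z. e / (?I + 1) * norm (F z) \<partial>lborel)"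
      proof (rule integral_mono')
        show "integrable lborel (\<lambda>z. e / (?I + 1) * norm (F z))"
          using F_int by (intro integrable_mult_right integrable_norm)
        fix z
        have "norm (F z * of_real (h (gauss_embed z)) - F z * of_real (P (gauss_embed z)))
            = \<bar>h (gauss_embed z) - P (gauss_embed z)\<bar> * norm (F z)"
          by (simp add: norm_mult flip: right_diff_distrib of_real_diff)
        also have "\<dots> \<le> e / (?I + 1) * norm (F z)"
          using hP[OF gauss_embed_in_cball] by (intro mult_right_mono) (auto intro: less_imp_le)
        finally show "norm (F z * of_real (h (gauss_embed z)) - F z * of_real (P (gauss_embed z))) \<le> e / (?I + 1) * norm (F z)" .
        show "0 \<le> e / (?I + 1) * norm (F z)"
          using \<open>0 < e / (?I + 1)\<close> by (intro mult_nonneg_nonneg) auto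
      qed
      also have "\<dots> = e * (?I / (?I + 1))"
        by simp
      also have "\<dots> \<le> e"
      proof (rule mult_left_le)
        show "?I / (?I + 1) \<le> 1"
          by (subst divide_le_eq_1_pos) (use I in linarith)+
      qed (use that in simp)
      finally show ?thesis .
    qed
    have "norm (\<integral>z. F z * of_real (h (gauss_embed z)) \<partial>lborel) \<le> 0"
      by (rule field_le_epsilon) (simp only: add_0 small)
    then show ?thesis
      by (simp only: norm_le_zero_iff)
  qed
  have closed: "set_lebesgue_integral lborel (gauss_embed -` C) F = 0" if C: "closed C" for C
  proof (cases "C = {}")
    case False
    \<comment> \<open>Equal to 1 on \<open>C\<close> and tending to 0 off it, where the distance to
      a closed set is positive. The empty set is treated apart because \<open>infdist x {}\<close>
      is 0 by convention.\<close>
    let ?h = "\<lambda>n x. max 0 (1 - real n * infdist x C)"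
    have h1: "\<bar>?h n x\<bar> \<le> 1" for n x
      using infdist_nonneg[of x C] by (simp add: abs_le_iff)
    have hc: "continuous_on UNIV (?h n)" for n
      by (intro continuous_intros)
    have [measurable]: "?h n \<in> borel_measurable borel" for n
      using hc by (rule borel_measurable_continuous_onI)
    have [measurable]: "C \<in> sets borel"
      using C by simp
    have "(\<lambda>n. \<integral>z. F z * of_real (?h n (gauss_embed z)) \<partial>lborel)
        \<longlonglongrightarrow> (\<integral>z. F z * of_real (indicator C (gauss_embed z)) \<partial>lborel)"
    proof (rule integral_dominated_convergence[where w = "\<lambda>z. norm (F z)"])
      show "integrable lborel (\<lambda>z. norm (F z))"
        using F_int by simp
      show "AE z in lborel. norm (F z * of_real (?h n (gauss_embed z))) \<le> norm (F z)" for n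
        using h1[of n] by (simp add: norm_mult mult_left_le)
      have "(\<lambda>n. ?h n x) \<longlonglongrightarrow> indicator C x" for x
      proof (cases "x \<in> C")
        case True
        then show ?thesis by simp
      next
        case F: False
        then have d: "0 < infdist x C"
          using in_closed_iff_infdist_zero[OF C False] infdist_nonneg[of x C] by (simp add: less_le)
        obtain N :: nat where N: "1 / infdist x C < real N"
          using reals_Archimedean2 by blast
        have "\<forall>\<^sub>F n in sequentially. ?h n x = 0"
          using eventually_ge_at_top[of N]
        proof eventually_elim
          case (elim n)
          then have "1 / infdist x C \<le> real n"
            using N by linarith
          then show ?case
            using d by (simp add: field_simps)
        qed
        then show ?thesis
          using F by (simp add: tendsto_eventually)
      qed
      then show "AE z in lborel. (\<lambda>n. F z * of_real (?h n (gauss_embed z))) \<longlonglongrightarrow> F z * of_real (indicator C (gauss_embed z))"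
        by (intro AE_I2 tendsto_mult tendsto_const tendsto_of_real)
    qed measurable
    then have "(\<integral>z. F z * of_real (indicator C (gauss_embed z)) \<partial>lborel) = 0"
      unfolding cont[OF hc h1] by (rule LIMSEQ_unique[OF _ tendsto_const])
    moreover have "F z * of_real (indicator C (gauss_embed z)) = indicator (gauss_embed -` C) z *\<^sub>R F z" for z
      by (simp split: split_indicator)
    ultimately show ?thesis
      by (simp add: set_lebesgue_integral_def)
  qed (simp add: set_lebesgue_integral_def)
  have F_set: "set_integrable lborel A F" if "A \<in> sets borel" for A
    unfolding set_integrable_def using that F_int by (intro integrable_mult_indicator) auto
  have vim: "gauss_embed -` A \<in> sets borel" if "A \<in> sets borel" for A
    using measurable_sets[OF gauss_embed_measurable that] by simp
  \<comment> \<open>Closed sets are an intersection-stable generator. Complements need the total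
    integral to vanish, which is the closed set \<open>UNIV\<close>.\<close>
  have borel: "set_lebesgue_integral lborel (gauss_embed -` A) F = 0" if "A \<in> sets borel" for A
  proof -
    have "Int_stable (Collect closed :: (complex \<times> real) set set)"
      by (auto simp: Int_stable_def)
    moreover have "(Collect closed :: (complex \<times> real) set set) \<subseteq> Pow UNIV"
      by simp
    moreover have sb: "sigma_sets UNIV (Collect closed :: (complex \<times> real) set set) = sets borel"
      by (simp add: borel_eq_closed)
    then have "A \<in> sigma_sets UNIV (Collect closed)"
      using that by simp
    ultimately show ?thesis
    proof (induction rule: sigma_sets_induct_disjoint)
      case (basic A)
      then show ?case by (simp add: closed)
    next
      case empty
      then show ?case by (simp add: set_lebesgue_integral_def)
    next
      case (compl A)
      then have A: "A \<in> sets borel" by (simp add: sb)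
      have "set_lebesgue_integral lborel (gauss_embed -` A \<union> gauss_embed -` (UNIV - A)) F
          = set_lebesgue_integral lborel (gauss_embed -` A) F + set_lebesgue_integral lborel (gauss_embed -` (UNIV - A)) F"
        using vim[OF A] vim[of "UNIV - A"] A by (intro set_integral_Un F_set) auto
      moreover have "gauss_embed -` A \<union> gauss_embed -` (UNIV - A) = gauss_embed -` UNIV"
        by auto
      ultimately show ?case
        using compl closed[of UNIV] by simp
    next
      case (union A)
      have A: "A i \<in> sets borel" for i
        using union(2) sb by auto
      have "set_lebesgue_integral lborel (\<Union>i. gauss_embed -` A i) F
          = (\<Sum>i. set_lebesgue_integral lborel (gauss_embed -` A i) F)"
      proof (rule lebesgue_integral_countable_add)
        show "gauss_embed -` A i \<in> sets lborel" for i
          using vim[OF A] by simp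
        show "gauss_embed -` A i \<inter> gauss_embed -` A j = {}" if "i \<noteq> j" for i j
        proof -
          have "A i \<inter> A j = {}"
            using union(1) that by (simp add: disjoint_family_on_def)
          then show ?thesis
            by (simp flip: vimage_Int)
        qed
        show "set_integrable lborel (\<Union>i. gauss_embed -` A i) F"
          using vim[OF A] by (intro F_set) auto
      qed
      then show ?case
        using union(3) by (simp add: vimage_UN)
    qed
  qed
  have "AE z in lborel. F z = 0"
  proof (rule sigma_finite_measure.density_zero[OF sigma_finite_lborel F_int])
    fix B :: "complex set" assume "B \<in> sets lborel"
    then have [measurable]: "B \<in> sets borel" by simp
    \<comment> \<open>A point z is recovered from its image (w, s) as w / s, which exhibits
      \<open>B\<close> as the preimage of a Borel set.\<close>
    let ?A = "{x :: complex \<times> real. 0 < snd x \<and> fst x / of_real (snd x) \<in> B}"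
    have "{x \<in> space (borel \<Otimes>\<^sub>M borel). 0 < snd x \<and> fst x / complex_of_real (snd x) \<in> B}
        \<in> sets (borel \<Otimes>\<^sub>M borel)"
      by measurable
    then have "?A \<in> sets borel"
      unfolding borel_prod by simp
    moreover have "gauss_embed -` ?A = B"
      by (auto simp: gauss_embed_def)
    ultimately show "set_lebesgue_integral lborel B F = 0"
      using borel[of ?A] by simp
  qed
  then show ?thesis
    by (simp add: F_def)
qed

end

section \<open>Twisted means along the two axes\<close>

lemma twisted_gaussian_kernel:
  fixes z u :: complex and t :: real
  shows "exp (\<i> / 2 * of_real (Im (z * cnj (z - u)))) * of_real (exp (- t * (norm (z - u))\<^sup>2))
    = of_real (exp (- t * (norm z)\<^sup>2)) * (exp (- of_real (t * (norm u)\<^sup>2))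
      * exp (of_real (t + 1 / 4) * cnj z * u + of_real (t - 1 / 4) * z * cnj u))"
proof -
  have "\<i> / 2 * of_real (Im (z * cnj (z - u))) + of_real (- t * (norm (z - u))\<^sup>2)
      = of_real (- t * (norm z)\<^sup>2) + (- of_real (t * (norm u)\<^sup>2)
        + (of_real (t + 1 / 4) * cnj z * u + of_real (t - 1 / 4) * z * cnj u))"
    unfolding cmod_power2 by (simp add: complex_eq_iff power2_eq_square field_simps)
  then show ?thesis
    by (simp only: exp_add[symmetric] exp_of_real[symmetric])
qed

lemma (in gaussian_integrable) twisted_gaussian_integral_eq_0:
  fixes z :: complex
  assumes eq: "AE u in lborel. f u = g u"
    and zero: "\<And>r. 0 < r \<Longrightarrow> twisted_mean f r z = 0" and t: "0 < t"
  shows "(\<integral>u. g u * (exp (- of_real (t * (norm u)\<^sup>2))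
    * exp (of_real (t + 1 / 4) * cnj z * u + of_real (t - 1 / 4) * z * cnj u)) \<partial>lborel) = 0"
proof -
  let ?k = "\<lambda>u. exp (\<i> / 2 * of_real (Im (z * cnj (z - u)))) * complex_of_real (exp (- t * (norm (z - u))\<^sup>2))"
  have int: "integrable lborel (\<lambda>u. g u * ?k u)"
  proof (rule integrable_dominated[OF _ t])
    fix u
    \<comment> \<open>By the reverse triangle inequality the Gaussian centred at \<open>z\<close> is
      at most the centred one times exp(2 t |z| |u|).\<close>
    have "(norm u - norm z)\<^sup>2 \<le> (norm (z - u))\<^sup>2"
      using norm_triangle_ineq3[of u z] by (metis abs_le_square_iff abs_norm_cancel norm_minus_commute)
    then have "(norm u)\<^sup>2 - 2 * norm z * norm u \<le> (norm (z - u))\<^sup>2"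
      unfolding power2_diff using zero_le_power2[of "norm z"] by (simp only: mult.commute mult.left_commute)
    from mult_left_mono[OF this, of t]
    have "- t * (norm (z - u))\<^sup>2 \<le> - t * (norm u)\<^sup>2 + 2 * t * norm z * norm u"
      using t by (simp add: algebra_simps)
    then show "norm (?k u) \<le> exp (- t * (norm u)\<^sup>2 + 2 * t * norm z * norm u)"
      by (simp add: norm_mult)
  qed measurable
  have m: "(\<lambda>v. z - v) \<in> measurable lborel borel"
    by measurable
  have meas: "(\<lambda>u. g u * ?k u) \<in> borel_measurable borel"
    by measurable
  have "integrable lborel (\<lambda>v. g (z - v) * ?k (z - v))"
    using integrable_distr[OF m, of "\<lambda>u. g u * ?k u"] int by (simp only: lborel_distr_diff)
  then have "(\<integral>v. g (z - v) * exp (\<i> / 2 * of_real (Im (z * cnj v))) * of_real (exp (- t * (norm v)\<^sup>2)) \<partial>lborel) = 0"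
    by (intro twisted_radial_integral_eq_0[OF borel_g eq, where k = "\<lambda>r. of_real (exp (- t * r\<^sup>2))"] zero)
      (auto simp: mult.assoc)
  moreover have "(\<integral>v. g (z - v) * ?k (z - v) \<partial>lborel) = (\<integral>u. g u * ?k u \<partial>lborel)"
    using integral_distr[OF m meas] by (simp only: lborel_distr_diff)
  ultimately have "(\<integral>u. g u * ?k u \<partial>lborel) = 0"
    by (simp add: mult.assoc)
  moreover have "g u * ?k u = of_real (exp (- t * (norm z)\<^sup>2)) * (g u * (exp (- of_real (t * (norm u)\<^sup>2))
      * exp (of_real (t + 1 / 4) * cnj z * u + of_real (t - 1 / 4) * z * cnj u)))" for u
    unfolding twisted_gaussian_kernel by (rule mult.left_commute)
  ultimately have "of_real (exp (- t * (norm z)\<^sup>2)) * (\<integral>u. g u * (exp (- of_real (t * (norm u)\<^sup>2))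
      * exp (of_real (t + 1 / 4) * cnj z * u + of_real (t - 1 / 4) * z * cnj u)) \<partial>lborel) = (0 :: complex)"
    by (simp only: integral_mult_right_zero)
  then show ?thesis
    by (simp only: mult_eq_0_iff of_real_eq_0_iff exp_not_eq_zero simp_thms)
qed

theorem theorem3p6:
  fixes q :: real and f :: "complex \<Rightarrow> complex"
  assumes "1 \<le> q" and "q \<le> 2"
    and "f \<in> Lspace q"
    and "\<And>r x :: real. r > 0 \<Longrightarrow>
           twisted_mean f r (of_real x) = 0 \<and> twisted_mean f r (\<i> * of_real x) = 0"
  shows "AE z in lebesgue. f z = 0"
proof -
  have f: "f \<in> borel_measurable lebesgue" "integrable lebesgue (\<lambda>z. norm (f z) powr q)"
    using assms(3) by (simp_all add: Lspace_def)
  obtain g where g: "g \<in> borel_measurable lborel" and eq: "AE z in lborel. f z = g z"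
    using completion_ex_borel_measurable_complex[OF f(1)] .
  have gb [measurable]: "g \<in> borel_measurable borel"
    using g by simp
  have "integrable lebesgue (\<lambda>z. norm (g z) powr q)"
  proof (rule integrable_cong_AE_imp[OF f(2)])
    show "(\<lambda>z. norm (g z) powr q) \<in> borel_measurable lebesgue"
      by (rule measurable_completion) measurable
    show "AE z in lebesgue. norm (f z) powr q = norm (g z) powr q"
      using AE_completion[OF eq] by (rule eventually_mono) simp
  qed
  then have Lq: "integrable lborel (\<lambda>z. norm (g z) powr q)"
    by (subst (asm) integrable_completion) measurable
  interpret gaussian_integrable g
    using integrable_Lp_gaussian[OF gb assms(1) Lq] gb
    by unfold_locales auto
  have "(\<integral>z. g z * (exp (- of_real (t * (norm z)\<^sup>2))
      * (of_real (4 * t + 1) * z + \<sigma> * of_real (4 * t - 1) * cnj z) ^ n) \<partial>lborel) = 0"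
    if t: "1 / 4 < t" and \<sigma>: "\<sigma> \<in> {1, -1}" for n t \<sigma>
  proof -
    have t0: "0 < t" using t by simp
    define a b c where "a = complex_of_real (4 * t + 1)" and "b = \<sigma> * complex_of_real (4 * t - 1)"
      and "c = (if \<sigma> = 1 then 1 else - \<i>)"
    have exp0: "(\<integral>u. g u * (exp (- of_real (t * (norm u)\<^sup>2)) * exp (of_real x * (c * a * u + c * b * cnj u))) \<partial>lborel) = 0"
      for x :: real
    proof -
      define z where "z = (if \<sigma> = 1 then of_real (4 * x) else \<i> * of_real (4 * x))"
      have "twisted_mean f r z = 0" if "0 < r" for r
        using assms(4)[OF that, of "4 * x"] by (simp add: z_def)
      from twisted_gaussian_integral_eq_0[OF eq this t0]
      have "(\<integral>u. g u * (exp (- of_real (t * (norm u)\<^sup>2))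
        * exp (of_real (t + 1 / 4) * cnj z * u + of_real (t - 1 / 4) * z * cnj u)) \<partial>lborel) = 0" .
      moreover have "of_real (t + 1 / 4) * cnj z * u + of_real (t - 1 / 4) * z * cnj u
          = of_real x * (c * a * u + c * b * cnj u)" for u
        using \<sigma> by (auto simp: z_def a_def b_def c_def algebra_simps)
      ultimately show ?thesis
        by (simp only:)
    qed
    have "(\<integral>u. g u * (exp (- of_real (t * (norm u)\<^sup>2)) * (c * a * u + c * b * cnj u) ^ n) \<partial>lborel) = 0"
      using gaussian_exp_power_eq_0[OF t0 exp0, of n 0] by simp
    moreover have "g u * (exp (- of_real (t * (norm u)\<^sup>2)) * (c * a * u + c * b * cnj u) ^ n)
        = c ^ n * (g u * (exp (- of_real (t * (norm u)\<^sup>2)) * (a * u + b * cnj u) ^ n))" for u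
    proof -
      have "c * a * u + c * b * cnj u = c * (a * u + b * cnj u)"
        by (simp add: algebra_simps)
      then show ?thesis
        by (simp only: power_mult_distrib mult_ac)
    qed
    ultimately have "c ^ n * (\<integral>u. g u * (exp (- of_real (t * (norm u)\<^sup>2)) * (a * u + b * cnj u) ^ n) \<partial>lborel) = 0"
      by (simp only: integral_mult_right_zero)
    moreover have "c ^ n \<noteq> 0"
      by (simp add: c_def)
    ultimately show ?thesis
      by (simp only: a_def b_def mult_eq_0_iff simp_thms)
  qed
  then have "moment j k t = 0" if "1 \<le> t" for j k t
    by (rule moments_eq_0) (use that in simp_all)
  then have "AE z in lborel. g z = 0"
    by (rule AE_eq_0_if_moments_eq_0)
  with eq have "AE z in lborel. f z = 0"
    by eventually_elim simp
  then show ?thesis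
    by (rule AE_completion)
qed

end
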